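(* Let $N\ge 1000$ and $M\ge 0$ be real numbers, let $\delta>0$, and let $\mathcal{B}$ be a $\delta$-well spaced subset of $\mathbb{R}/\mathbb{Z}$. For any function $f:\mathcal{B}\to\mathbb{C}$ that is not identically zero, we have $$\sum_{M+1\le p\le M+N}\Bigl|\sum_{b\in\mathcal{B}}f(b)e(bp)\Bigr|^2\le 280\,(N+\delta^{-1})\,\|f\|_2^2\,\frac{\log\bigl(2\|f\|_1^2/\|f\|_2^2\bigr)}{\log N}.$$
   Context: The variable $p$ denotes a prime number, and the sum over $M+1\le p\le M+N$ runs over primes. We write $e(\alpha)=\exp(2i\pi\alpha)$, and $|y|_{\mathbb{Z}}=\min_{k\in\mathbb{Z}}|y-k|$ for the distance of $y$ to the nearest integer. A set $\mathcal{B}\subset\mathbb{R}/\mathbb{Z}$ is called $\delta$-well spaced when $|b-b'|_{\mathbb{Z}}\ge\delta$ for all distinct $b,b'\in\mathcal{B}$ (such a set is finite). For $q>0$, $\|f\|_q$ is defined by $\|f\|_q^q=\sum_{b\in\mathcal{B}}|f(b)|^q$. *)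

theory Defs
  imports "HOL-Analysis.Analysis" "HOL-Computational_Algebra.Primes"
begin

definition dist_nearest_int :: "real \<Rightarrow> real" where
  "dist_nearest_int y = (INF k::int. \<bar>y - of_int k\<bar>)"

text \<open>The infimum is attained, so it is the minimum over all integers.\<close>

lemma dist_nearest_int_le: "dist_nearest_int y \<le> \<bar>y - of_int k\<bar>"
  unfolding dist_nearest_int_def by (rule cINF_lower) (auto intro!: bdd_belowI[of _ 0])

lemma dist_nearest_int_attained: "\<exists>k::int. dist_nearest_int y = \<bar>y - of_int k\<bar>"
proof -
  have "dist_nearest_int y = \<bar>y - of_int (round y)\<bar>"
  proof (rule antisym)
    show "\<bar>y - of_int (round y)\<bar> \<le> dist_nearest_int y"
      unfolding dist_nearest_int_def by (rule cINF_greatest) (auto simp: round_diff_minimal)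
  qed (rule dist_nearest_int_le)
  then show ?thesis by blast
qed

lemma dist_nearest_int_cong:
  assumes "x - y \<in> \<int>"
  shows "dist_nearest_int x = dist_nearest_int y"
proof -
  have le: "dist_nearest_int a \<le> dist_nearest_int b" if ab: "a - b \<in> \<int>" for a b :: real
  proof -
    obtain k :: int where k: "dist_nearest_int b = \<bar>b - of_int k\<bar>"
      using dist_nearest_int_attained by blast
    obtain n :: int where "a - b = of_int n"
      using ab by (auto elim: Ints_cases)
    then have "\<bar>b - of_int k\<bar> = \<bar>a - of_int (k + n)\<bar>" by simp
    then show ?thesis using k dist_nearest_int_le by metis
  qed
  have "y - x \<in> \<int>" using Ints_minus[OF assms] by simp
  then show ?thesis using le[OF assms] le[of y x] by (intro antisym)
qed

quotient_type real_mod_int = real / "\<lambda>x y::real. x - y \<in> \<int>"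
proof (rule equivpI)
  show "reflp (\<lambda>x y::real. x - y \<in> \<int>)" by (simp add: reflp_def)
  show "symp (\<lambda>x y::real. x - y \<in> \<int>)"
    by (rule sympI) (metis Ints_minus minus_diff_eq)
  show "transp (\<lambda>x y::real. x - y \<in> \<int>)"
  proof (rule transpI)
    fix x y z :: real
    assume "x - y \<in> \<int>" "y - z \<in> \<int>"
    then have "(x - y) + (y - z) \<in> \<int>" by (rule Ints_add)
    then show "x - z \<in> \<int>" by simp
  qed
qed

instantiation real_mod_int :: ab_group_add
begin

lift_definition zero_real_mod_int :: real_mod_int is "0::real" .

lift_definition plus_real_mod_int :: "real_mod_int \<Rightarrow> real_mod_int \<Rightarrow> real_mod_int"
  is "(+) :: real \<Rightarrow> real \<Rightarrow> real"
  by (metis Ints_add add_diff_add)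

lift_definition uminus_real_mod_int :: "real_mod_int \<Rightarrow> real_mod_int"
  is "uminus :: real \<Rightarrow> real"
  by (metis Ints_minus minus_diff_minus)

lift_definition minus_real_mod_int :: "real_mod_int \<Rightarrow> real_mod_int \<Rightarrow> real_mod_int"
  is "(-) :: real \<Rightarrow> real \<Rightarrow> real"
proof -
  fix a b c d :: real
  assume "a - b \<in> \<int>" "c - d \<in> \<int>"
  then have "(a - b) - (c - d) \<in> \<int>" by (rule Ints_diff)
  then show "(a - c) - (b - d) \<in> \<int>" by (simp add: algebra_simps)
qed

instance
  by standard (transfer; simp)+

end

lift_definition smult_nat :: "nat \<Rightarrow> real_mod_int \<Rightarrow> real_mod_int"
  is "\<lambda>n x. of_nat n * x"
  by (metis Ints_mult Ints_of_nat right_diff_distrib)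

lift_definition norm_mod_int :: "real_mod_int \<Rightarrow> real"
  is dist_nearest_int
  by (rule dist_nearest_int_cong)

lift_definition e :: "real_mod_int \<Rightarrow> complex"
  is "\<lambda>x. exp (2 * \<i> * of_real pi * of_real x)"
proof -
  fix x y :: real
  assume "x - y \<in> \<int>"
  then obtain n :: int where "x - y = of_int n" by (rule Ints_cases)
  then have x: "x = y + of_int n" by simp
  show "exp (2 * \<i> * of_real pi * of_real x) = exp (2 * \<i> * of_real pi * of_real y)"
    unfolding exp_eq by (rule exI[of _ n]) (simp add: x algebra_simps)
qed

definition well_spaced :: "real \<Rightarrow> real_mod_int set \<Rightarrow> bool" where
  "well_spaced \<delta> B \<longleftrightarrow> (\<forall>b\<in>B. \<forall>b'\<in>B. b \<noteq> b' \<longrightarrow> \<delta> \<le> norm_mod_int (b - b'))"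

text \<open>The function \<open>f\<close> on \<open>B\<close> is represented by a total function; only its values on \<open>B\<close> matter.\<close>

definition lq_norm :: "real_mod_int set \<Rightarrow> real \<Rightarrow> (real_mod_int \<Rightarrow> complex) \<Rightarrow> real" where
  "lq_norm B q f = (\<Sum>b\<in>B. cmod (f b) powr q) powr (1 / q)"

end

theory Submission
  imports Defs "HOL-Computational_Algebra.Squarefree"
begin

text \<open>Write \<open>e(t) = cis (2 * pi * t)\<close>, \<open>F1 = (\<Sum>b\<in>B. \<bar>f b\<bar>)\<close>, \<open>F2 = (\<Sum>b\<in>B. \<bar>f b\<bar>\<^sup>2)\<close>,
\<open>K = F1\<^sup>2 / F2 \<ge> 1\<close>, and let \<open>T n = (\<Sum>b\<in>B. f b * e(n b))\<close>.  The large sieve bounds the sum of \<open>\<bar>T n\<bar>\<^sup>2\<close> over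
all integers of the interval by a multiple of \<open>(N + 1/\<delta>) * F2\<close>; the point is to gain the factor
\<open>ln (2 K) / ln N\<close> when the sum is restricted to primes.  The gain comes from sieving by the primes in
\<open>(4 K\<^sup>2, N powr (1/4)]\<close> only.

Let \<open>q\<close> run over the squarefree numbers up to \<open>N powr (1/4)\<close> all of whose prime factors exceed \<open>4 K\<^sup>2\<close>, and
let \<open>G\<close> be the sum of their reciprocals.  If \<open>n\<close> is coprime to all these \<open>q\<close>, then each Ramanujan sum
\<open>c_q(n)\<close> equals \<open>\<mu>(q)\<close>, hence \<open>G * T n = (\<Sum>b, q, a. f b * \<mu>(q) / q * e(n (b + a/q)))\<close> with \<open>a\<close> running
through the reduced residues modulo \<open>q\<close> (lemma \<open>sieve_identity\<close>).  The right-hand side makes sense for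
every integer \<open>n\<close>, and Bessel's inequality for step functions supported on arcs of length
\<open>1/(2N)\<close> around the points \<open>b + a/q\<close> bounds its mean square by a multiple of \<open>N\<close> times the sum of
the products of coefficients over pairs of points at distance less than \<open>1/(2N)\<close>
(lemma \<open>large_sieve_overlap\<close>).

It remains to bound, for fixed \<open>b\<close> and \<open>b'\<close>, the sum of \<open>1/(q q')\<close> over the pairs with \<open>b - b' + a/q - a'/q'\<close>
close to an integer.  Differences of two numbers \<open>a/q - a'/q'\<close> have denominator at most \<open>N\<close>, so all these pairs
have the same value \<open>a/q - a'/q'\<close> modulo \<open>1\<close>, and each \<open>a/q\<close> has at most one partner: the sum is at
most \<open>G\<close>.  When \<open>b\<close> and \<open>b'\<close> are far apart, that common value is not an integer, so some prime
\<open>p > 4 K\<^sup>2\<close> of its denominator divides \<open>q\<close> or \<open>q'\<close> in every pair, and the sum is at most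
\<open>2 G / sqrt p \<le> G / K\<close> (lemma \<open>correlation_far_le\<close>).  The far pairs thus contribute \<open>G / K * F1\<^sup>2 = G * F2\<close>,
no more than the near ones, and dividing by \<open>G\<^sup>2\<close> gives \<open>O((N + 1/\<delta>) * F2 / G)\<close>
(lemma \<open>large_sieve_sifted\<close>).

Finally \<open>1 / G\<close> is \<open>O(ln (2 K) / ln N)\<close>: the reciprocals of all squarefree numbers up to \<open>z\<close> have sum at least
\<open>ln z / \<zeta>(2)\<close>, and discarding the multiples of the primes up to \<open>r\<close> costs at most the factor
\<open>(\<Prod>p\<le>r. 1 + 1/p) \<le> 4.2 * ln r\<close>, a weak form of Mertens' theorem
(lemmas \<open>prod_one_plus_inverse_primes_le\<close> and \<open>sieve_sum_lower_bound\<close>).  The primes up to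
\<open>N powr (1/4)\<close> escape the sieve; they are estimated trivially, which suffices because \<open>K\<close> may be assumed to be
less than a small power of \<open>N\<close>, the large sieve alone being strong enough otherwise.\<close>

section \<open>The distance to the nearest integer\<close>

lemma dist_nearest_int_minus: "dist_nearest_int (- x) = dist_nearest_int x"
proof -
  have "dist_nearest_int (- y) \<le> dist_nearest_int y" for y
  proof -
    obtain k :: int where "dist_nearest_int y = \<bar>y - of_int k\<bar>"
      using dist_nearest_int_attained by blast
    then show ?thesis using dist_nearest_int_le[of "- y" "- k"] by simp
  qed
  from this[of x] this[of "- x"] show ?thesis by simp
qed

lemma dist_nearest_int_triangle:
  "dist_nearest_int (x + y) \<le> dist_nearest_int x + dist_nearest_int y"
proof -
  obtain k l :: int where "dist_nearest_int x = \<bar>x - of_int k\<bar>" "dist_nearest_int y = \<bar>y - of_int l\<bar>"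
    using dist_nearest_int_attained by metis
  then show ?thesis using dist_nearest_int_le[of "x + y" "k + l"] by simp
qed

lemma dist_nearest_int_triangle_diff:
  "dist_nearest_int (x - y) \<le> dist_nearest_int x + dist_nearest_int y"
  using dist_nearest_int_triangle[of x "- y"] by (simp add: dist_nearest_int_minus)

lemma dist_nearest_int_le_abs: "dist_nearest_int x \<le> \<bar>x\<bar>"
  using dist_nearest_int_le[of x 0] by simp

lemma dist_nearest_int_eq_abs:
  assumes "\<bar>x\<bar> \<le> 1/2"
  shows "dist_nearest_int x = \<bar>x\<bar>"
proof (rule antisym[OF dist_nearest_int_le_abs])
  obtain k :: int where k: "dist_nearest_int x = \<bar>x - of_int k\<bar>"
    using dist_nearest_int_attained by blast
  show "\<bar>x\<bar> \<le> dist_nearest_int x"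
  proof (cases "k = 0")
    case False
    then have "1 \<le> \<bar>real_of_int k\<bar>" by linarith
    then show ?thesis using assms unfolding k by linarith
  qed (simp add: k)
qed

lemma dist_nearest_int_add_1 [simp]: "dist_nearest_int (x + 1) = dist_nearest_int x"
  by (rule dist_nearest_int_cong) simp

lemma continuous_dist_nearest_int: "continuous_on A dist_nearest_int"
proof -
  have "1-lipschitz_on A dist_nearest_int"
  proof (rule lipschitz_onI)
    fix x y :: real
    show "dist (dist_nearest_int x) (dist_nearest_int y) \<le> 1 * dist x y"
      using dist_nearest_int_triangle[of "x - y" y] dist_nearest_int_triangle[of "y - x" x]
        dist_nearest_int_le_abs[of "x - y"] dist_nearest_int_le_abs[of "y - x"]
      by (simp add: dist_real_def)
  qed simp
  then show ?thesis by (rule lipschitz_on_continuous_on)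
qed

section \<open>Bessel's inequality for arcs of the circle\<close>

lemma has_integral_shift_real:
  fixes g :: "real \<Rightarrow> 'a::banach"
  assumes "(g has_integral I) {a..b}"
  shows "((\<lambda>u. g (u - t)) has_integral I) {a + t..b + t}"
  using has_integral_affinity[of g I a b 1 "- t"] assms by (simp add: add.commute)

lemma has_integral_periodic:
  fixes g :: "real \<Rightarrow> 'a::banach"
  assumes per: "\<And>u. g (u + 1) = g u"
    and I: "(g has_integral I) {c..c + 1}"
  shows "(g has_integral I) {a..a + 1}"
proof -
  have perZ: "g (u - of_int n) = g u" for u and n :: int
  proof (induction n rule: int_induct[of _ 0])
    case base then show ?case by simp
  next
    case (step1 i)
    then show ?case using per[of "u - of_int i - 1"] by (simp add: algebra_simps)
  next
    case (step2 i)
    then show ?case using per[of "u - of_int i"] by (simp add: algebra_simps)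
  qed
  have shift: "(g has_integral J) {x + of_int n..y + of_int n}" if "(g has_integral J) {x..y}" for x y J and n :: int
    using has_integral_shift_real[OF that, of "of_int n"] by (simp add: perZ)
  define n where "n = \<lfloor>a - c\<rfloor>"
  define s where "s = c + frac (a - c)"
  have s: "c \<le> s" "s \<le> c + 1" "a = s + of_int n"
    using frac_ge_0[of "a - c"] frac_lt_1[of "a - c"] unfolding s_def n_def
    by (linarith, linarith) (simp add: frac_def)
  have "g integrable_on {c..c+1}" using I by blast
  then have "g integrable_on {c..s}" "g integrable_on {s..c+1}"
    using s by (auto intro: integrable_subinterval_real)
  then obtain J1 J2 where J: "(g has_integral J1) {c..s}" "(g has_integral J2) {s..c+1}"
    by blast
  from has_integral_combine[OF s(1,2) J] have "I = J1 + J2"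
    using I has_integral_unique by blast
  moreover have "(g has_integral J2 + J1) {s..s+1}"
    using has_integral_combine[OF _ _ J(2), of "s+1" J1] shift[OF J(1), of 1] s by simp
  ultimately have "(g has_integral I) {s..s+1}" by (simp add: add.commute)
  from shift[OF this, of n] show ?thesis by (simp add: s(3) algebra_simps)
qed

text \<open>The indicator function of the open arc of radius \<open>h\<close> around \<open>0\<close> on the circle, viewed as a
\<open>1\<close>-periodic function on the line, so that translated arcs may wrap around; it is complex-valued because it
is multiplied by characters.\<close>

definition arc :: "real \<Rightarrow> real \<Rightarrow> complex" where
  "arc h u = (if dist_nearest_int u < h then 1 else 0)"

text \<open>The \<open>n\<close>-th Fourier coefficient of \<open>arc h\<close> (for \<open>h \<le> 1/2\<close>).\<close>

definition arc_coeff :: "real \<Rightarrow> int \<Rightarrow> complex" where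
  "arc_coeff h n = integral {-h..h} (\<lambda>v. cis (- 2 * pi * of_int n * v))"

lemma cis_int_multiple: "x - y \<in> \<int> \<Longrightarrow> cis (2 * pi * of_int n * x) = cis (2 * pi * of_int n * y)"
proof -
  assume "x - y \<in> \<int>"
  then obtain k :: int where "x - y = of_int k" by (rule Ints_cases)
  then have "x = y + of_int k" by simp
  then have "cis (2 * pi * of_int n * x) = cis (2 * pi * of_int n * y) * cis (2 * pi * of_int (n * k))"
    by (simp add: cis_mult algebra_simps)
  also have "cis (2 * pi * of_int (n * k)) = 1"
    by (rule cis_multiple_2pi) simp
  finally show ?thesis by simp
qed

lemma has_integral_arc_cis:
  assumes h: "0 < h" "h \<le> 1/2"
  shows "((\<lambda>u. arc h (u - t) * cis (- 2 * pi * of_int n * u)) has_integral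
            cis (- 2 * pi * of_int n * t) * arc_coeff h n) {0..1}"
proof -
  let ?e = "\<lambda>v. cis (- 2 * pi * of_int n * v)"
  have "?e integrable_on {-h..h}" by (intro integrable_continuous_real continuous_intros)
  then have "(?e has_integral arc_coeff h n) {-h..h}"
    unfolding arc_coeff_def by (rule integrable_integral)
  then have "(?e has_integral arc_coeff h n) ({-h<..<h})"
    by (subst (asm) has_integral_Icc_iff_Ioo)
  then have "((\<lambda>v. if v \<in> {-h<..<h} then ?e v else 0) has_integral arc_coeff h n) {-1/2..-1/2+1}"
    using h by (subst has_integral_restrict) auto
  then have "((\<lambda>v. arc h v * ?e v) has_integral arc_coeff h n) {-1/2..-1/2+1}"
    by (rule has_integral_eq[rotated]) (auto simp: arc_def dist_nearest_int_eq_abs)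
  then have "((\<lambda>v. arc h v * ?e v) has_integral arc_coeff h n) {-t..-t+1}"
  proof (rule has_integral_periodic[rotated])
    fix u show "arc h (u + 1) * ?e (u + 1) = arc h u * ?e u"
      using cis_int_multiple[of "u+1" u "- n"] by (simp add: arc_def)
  qed
  from has_integral_shift_real[OF this, of t]
  have "((\<lambda>u. arc h (u - t) * ?e (u - t)) has_integral arc_coeff h n) {0..1}" by simp
  from has_integral_mult_right[OF this, of "?e t"]
  have "((\<lambda>u. ?e t * (arc h (u - t) * ?e (u - t))) has_integral ?e t * arc_coeff h n) {0..1}" .
  moreover have "?e t * (arc h (u - t) * ?e (u - t)) = arc h (u - t) * ?e u" for u
  proof -
    have "?e t * ?e (u - t) = ?e u" by (simp add: cis_mult algebra_simps)
    then show ?thesis by (metis mult.left_commute)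
  qed
  ultimately show ?thesis by (simp only:)
qed

lemma has_integral_cis_int:
  "((\<lambda>u. cis (2 * pi * of_int n * u)) has_integral (if n = 0 then 1 else 0)) {0..1}"
proof (cases "n = 0")
  case True
  then show ?thesis using has_integral_const_real[of "1::complex" 0 1] by simp
next
  case False
  define c where "c = 2 * pi * of_int n * \<i>"
  have c: "c \<noteq> 0" using False by (simp add: c_def)
  have e: "cis (2 * pi * of_int n * u) = exp (c * of_real u)" for u
    by (simp add: c_def cis_conv_exp mult_ac)
  have "((\<lambda>u. exp (c * of_real u)) has_integral exp (c * of_real 1) / c - exp (c * of_real 0) / c) {0..1}"
  proof (rule fundamental_theorem_of_calculus)
    fix u :: real
    show "((\<lambda>u. exp (c * of_real u) / c) has_vector_derivative exp (c * of_real u)) (at u within {0..1})"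
      by (rule has_vector_derivative_real_field) (use c in \<open>auto intro!: derivative_eq_intros\<close>)
  qed simp
  then show ?thesis using False cis_int_multiple[of 1 0 n] e[of 1] by (simp flip: e)
qed

text \<open>The value \<open>a\<close> is the measure of the intersection of two arcs of radius \<open>h\<close>: at most the length of one of them,
and zero when the centres are at distance at least \<open>2 h\<close>, by the triangle inequality.\<close>

lemma has_integral_arc_arc:
  assumes h: "0 < h" "h \<le> 1/2"
  shows "\<exists>a. ((\<lambda>u. arc h (u - t) * arc h (u - t')) has_integral (of_real a)) {0..1} \<and> 0 \<le> a \<and>
           a \<le> (if dist_nearest_int (t - t') < 2 * h then 2 * h else 0)"
proof -
  define U where "U = {u. dist_nearest_int (u - t) < h \<and> dist_nearest_int (u - t') < h}"
  have cont: "continuous_on UNIV (\<lambda>u. dist_nearest_int (u - x))" for x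
    by (rule continuous_on_compose2[OF continuous_dist_nearest_int[of UNIV]]) (auto intro!: continuous_intros)
  have "open U" unfolding U_def
    by (intro open_Collect_conj open_Collect_less cont continuous_intros)
  then have meas: "(indicator U :: real \<Rightarrow> real) \<in> borel_measurable (lebesgue_on {0..1})"
    by (intro measurable_restrict_space1 measurable_completion) (simp add: borel_measurable_indicator_iff)
  have eq: "arc h (u - t) * arc h (u - t') = of_real (indicator U u)" for u
    by (simp add: arc_def U_def)
  have int: "(indicator U :: real \<Rightarrow> real) integrable_on {0..1}"
    by (rule measurable_bounded_by_integrable_imp_integrable[OF meas, of "\<lambda>_. 1"])
       (auto simp: indicator_def)
  define a :: real where "a = integral {0..1} (indicator U :: real \<Rightarrow> real)"
  have a: "((indicator U :: real \<Rightarrow> real) has_integral a) {0..1}"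
    unfolding a_def using int by (rule integrable_integral)
  have "((\<lambda>u. of_real (indicator U u) :: complex) has_integral of_real a) {0..1}"
    using has_integral_linear[OF a bounded_linear_of_real] by (simp add: o_def)
  then have 1: "((\<lambda>u. arc h (u - t) * arc h (u - t')) has_integral of_real a) {0..1}"
    by (simp add: eq)
  have 2: "0 \<le> a" using a by (rule has_integral_nonneg) (auto simp: indicator_def)
  have coeff0: "arc_coeff h 0 = of_real (2 * h)"
    using h by (simp add: arc_coeff_def scaleR_conv_of_real)
  have "((\<lambda>u. arc h (u - t) * cis (- 2 * pi * of_int 0 * u)) has_integral of_real (2 * h)) {0..1}"
    using has_integral_arc_cis[OF h, of t 0] coeff0 by (simp only: of_int_0 mult_zero_right mult_zero_left cis_zero mult_1_left)
  from has_integral_linear[OF this bounded_linear_Re]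
  have "((\<lambda>u. Re (arc h (u - t))) has_integral 2 * h) {0..1}" by (simp add: o_def)
  from has_integral_le[OF a this] have 3: "a \<le> 2 * h"
    by (auto simp: indicator_def U_def arc_def)
  have 4: "a = 0" if "\<not> dist_nearest_int (t - t') < 2 * h"
  proof -
    have "U = {}"
    proof (rule ccontr)
      assume "U \<noteq> {}"
      then obtain u where "dist_nearest_int (u - t) < h" "dist_nearest_int (u - t') < h"
        unfolding U_def by blast
      then show False using that dist_nearest_int_triangle_diff[of "u - t'" "u - t"] by simp
    qed
    then have "(indicator U :: real \<Rightarrow> real) = (\<lambda>_. 0)" by auto
    then show ?thesis unfolding a_def by (simp only: integral_0)
  qed
  show ?thesis using 1 2 3 4 by (intro exI[of _ a]) auto
qed

text \<open>Bessel's inequality for the step function \<open>H u = (\<Sum>j\<in>J. c j * arc h (u - t j))\<close>.  Its Fourier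
coefficients factor into \<open>arc_coeff h n\<close> and the exponential sum, while its mean square only sees pairs
of overlapping arcs.  Arcs rather than a smooth kernel are used because this localisation is exact.\<close>

lemma bessel_arcs:
  fixes c :: "'j \<Rightarrow> complex" and t :: "'j \<Rightarrow> real" and S :: "int set"
  assumes h: "0 < h" "h \<le> 1/2" and J: "finite J" and S: "finite S"
  shows "(\<Sum>n\<in>S. (cmod (arc_coeff h n))\<^sup>2 * (cmod (\<Sum>j\<in>J. c j * cis (- 2 * pi * of_int n * t j)))\<^sup>2)
     \<le> 2 * h * (\<Sum>j\<in>J. \<Sum>k\<in>J. if dist_nearest_int (t j - t k) < 2 * h then cmod (c j) * cmod (c k) else 0)"
proof -
  define E where "E n u = cis (- 2 * pi * of_int n * u)" for n :: int and u
  define H where "H u = (\<Sum>j\<in>J. c j * arc h (u - t j))" for u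
  define d where "d n = (\<Sum>j\<in>J. c j * (E n (t j) * arc_coeff h n))" for n
  \<comment> \<open>\<open>d n\<close> is the Fourier coefficient of \<open>H\<close>, \<open>P\<close> the orthogonal projection of \<open>H\<close> to the frequencies in \<open>S\<close>;
    the claim is that the integral of \<open>\<bar>H - P\<bar>\<^sup>2\<close> is nonnegative.\<close>
  define P where "P u = (\<Sum>n\<in>S. d n * cnj (E n u))" for u
  have cnjE: "cnj (E n u) = E (- n) u" for n u by (simp add: E_def cis_cnj)
  have EE: "E n u * E m u = E (n + m) u" for n m u by (simp add: E_def cis_mult algebra_simps)
  have arc_real: "cnj (arc h u) = arc h u" for u by (simp add: arc_def)
  define Q where "Q x y a \<longleftrightarrow> ((\<lambda>u. arc h (u - x) * arc h (u - y)) has_integral (of_real a)) {0..1} \<and> 0 \<le> a \<and>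
      a \<le> (if dist_nearest_int (x - y) < 2 * h then 2 * h else 0)" for x y a
  have "\<forall>x y. \<exists>a. Q x y a" unfolding Q_def using has_integral_arc_arc[OF h] by blast
  then obtain A' where "\<And>x y. Q x y (A' x y)" by metis
  then obtain A where Q: "\<And>j k. Q (t j) (t k) (A j k)" by (rule that)
  have A: "((\<lambda>u. arc h (u - t j) * arc h (u - t k)) has_integral (of_real (A j k))) {0..1}"
      "0 \<le> A j k" "A j k \<le> (if dist_nearest_int (t j - t k) < 2 * h then 2 * h else 0)" for j k
    using Q[of j k] unfolding Q_def by blast+
  have HE: "((\<lambda>u. H u * E n u) has_integral d n) {0..1}" for n
    unfolding H_def d_def sum_distrib_right E_def mult.assoc[of "c _"]
    by (intro has_integral_sum J has_integral_mult_right has_integral_arc_cis h)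
  have HP: "((\<lambda>u. H u * cnj (P u)) has_integral (\<Sum>n\<in>S. cnj (d n) * d n)) {0..1}"
  proof -
    have "H u * cnj (P u) = (\<Sum>n\<in>S. cnj (d n) * (H u * E n u))" for u
      by (simp add: P_def sum_distrib_left mult_ac)
    then show ?thesis by (simp only:) (intro has_integral_sum S has_integral_mult_right HE)
  qed
  have "((\<lambda>u. cnj (H u * cnj (P u))) has_integral cnj (\<Sum>n\<in>S. cnj (d n) * d n)) {0..1}"
    using has_integral_linear[OF HP bounded_linear_cnj] by (simp add: o_def)
  then have PH: "((\<lambda>u. P u * cnj (H u)) has_integral (\<Sum>n\<in>S. cnj (d n) * d n)) {0..1}"
    by (simp add: mult.commute)
  have PP: "((\<lambda>u. P u * cnj (P u)) has_integral (\<Sum>n\<in>S. cnj (d n) * d n)) {0..1}"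
  proof -
    have "P u * cnj (P u) = (\<Sum>n\<in>S. \<Sum>m\<in>S. (d n * cnj (d m)) * E (m - n) u)" for u
    proof -
      have "E (m - n) u = E m u * cnj (E n u)" for m n by (simp add: cnjE EE)
      then show ?thesis unfolding P_def cnj_sum sum_product by (simp add: mult_ac)
    qed
    moreover have "((\<lambda>u. \<Sum>n\<in>S. \<Sum>m\<in>S. (d n * cnj (d m)) * E (m - n) u) has_integral
        (\<Sum>n\<in>S. \<Sum>m\<in>S. (d n * cnj (d m)) * (if m = n then 1 else 0))) {0..1}"
    proof (intro has_integral_sum S has_integral_mult_right)
      fix n m
      have "E (m - n) = (\<lambda>u. cis (2 * pi * of_int (n - m) * u))"
        by (simp add: E_def fun_eq_iff algebra_simps)
      then show "(E (m - n) has_integral (if m = n then 1 else 0)) {0..1}"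
        using has_integral_cis_int[of "n - m"] by (auto simp only: diff_eq_eq add_0_left split: if_splits)
    qed
    ultimately show ?thesis using S by (simp add: if_distrib[of "\<lambda>x. _ * x"] mult.commute cong: if_cong)
  qed
  have HH: "((\<lambda>u. H u * cnj (H u)) has_integral (\<Sum>j\<in>J. \<Sum>k\<in>J. c j * cnj (c k) * of_real (A j k))) {0..1}"
  proof -
    have "H u * cnj (H u) = (\<Sum>j\<in>J. \<Sum>k\<in>J. (c j * cnj (c k)) * (arc h (u - t j) * arc h (u - t k)))" for u
      unfolding H_def cnj_sum sum_product by (simp add: arc_real mult_ac)
    then show ?thesis by (simp only:) (intro has_integral_sum J has_integral_mult_right A)
  qed
  have "((\<lambda>u. H u * cnj (H u) - H u * cnj (P u) - P u * cnj (H u) + P u * cnj (P u)) has_integral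
     ((\<Sum>j\<in>J. \<Sum>k\<in>J. c j * cnj (c k) * of_real (A j k)) - (\<Sum>n\<in>S. cnj (d n) * d n)
       - (\<Sum>n\<in>S. cnj (d n) * d n) + (\<Sum>n\<in>S. cnj (d n) * d n))) {0..1}"
    by (intro has_integral_add has_integral_diff HH HP PH PP)
  from has_integral_linear[OF this bounded_linear_Re]
  have "((\<lambda>u. Re (H u * cnj (H u) - H u * cnj (P u) - P u * cnj (H u) + P u * cnj (P u))) has_integral
     Re ((\<Sum>j\<in>J. \<Sum>k\<in>J. c j * cnj (c k) * of_real (A j k)) - (\<Sum>n\<in>S. cnj (d n) * d n))) {0..1}"
    by (simp add: o_def)
  moreover have "H u * cnj (H u) - H u * cnj (P u) - P u * cnj (H u) + P u * cnj (P u)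
      = of_real ((cmod (H u - P u))\<^sup>2)" for u
    by (simp only: complex_norm_square) (simp add: algebra_simps)
  ultimately have "((\<lambda>u. (cmod (H u - P u))\<^sup>2) has_integral
     Re ((\<Sum>j\<in>J. \<Sum>k\<in>J. c j * cnj (c k) * of_real (A j k)) - (\<Sum>n\<in>S. cnj (d n) * d n))) {0..1}"
    by simp
  then have "0 \<le> Re ((\<Sum>j\<in>J. \<Sum>k\<in>J. c j * cnj (c k) * of_real (A j k)) - (\<Sum>n\<in>S. cnj (d n) * d n))"
    by (rule has_integral_nonneg) simp
  moreover have "Re (\<Sum>n\<in>S. cnj (d n) * d n) = (\<Sum>n\<in>S. (cmod (d n))\<^sup>2)"
  proof -
    have "cnj (d n) * d n = of_real ((cmod (d n))\<^sup>2)" for n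
      by (simp only: complex_norm_square mult.commute)
    then show ?thesis by simp
  qed
  ultimately have "(\<Sum>n\<in>S. (cmod (d n))\<^sup>2) \<le> (\<Sum>j\<in>J. \<Sum>k\<in>J. Re (c j * cnj (c k) * of_real (A j k)))"
    by simp
  also have "\<dots> \<le> (\<Sum>j\<in>J. \<Sum>k\<in>J. 2 * h * (if dist_nearest_int (t j - t k) < 2 * h then cmod (c j) * cmod (c k) else 0))"
  proof (intro sum_mono)
    fix j k
    have "Re (c j * cnj (c k) * of_real (A j k)) \<le> cmod (c j * cnj (c k) * of_real (A j k))"
      by (rule complex_Re_le_cmod)
    also have "\<dots> = cmod (c j) * cmod (c k) * A j k" using A(2) by (simp add: norm_mult)
    also have "\<dots> \<le> cmod (c j) * cmod (c k) * (if dist_nearest_int (t j - t k) < 2 * h then 2 * h else 0)"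
      by (intro mult_left_mono A) auto
    finally show "Re (c j * cnj (c k) * of_real (A j k)) \<le> 2 * h * (if dist_nearest_int (t j - t k) < 2 * h then cmod (c j) * cmod (c k) else 0)"
      by (auto simp: mult_ac split: if_splits)
  qed
  also have "\<dots> = 2 * h * (\<Sum>j\<in>J. \<Sum>k\<in>J. if dist_nearest_int (t j - t k) < 2 * h then cmod (c j) * cmod (c k) else 0)"
    by (simp add: sum_distrib_left)
  finally have "(\<Sum>n\<in>S. (cmod (d n))\<^sup>2) \<le> \<dots>" .
  moreover have "(cmod (d n))\<^sup>2 = (cmod (arc_coeff h n))\<^sup>2 * (cmod (\<Sum>j\<in>J. c j * cis (- 2 * pi * of_int n * t j)))\<^sup>2" for n
  proof -
    have "d n = arc_coeff h n * (\<Sum>j\<in>J. c j * E n (t j))"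
      by (simp add: d_def sum_distrib_left mult_ac)
    then show ?thesis by (simp add: norm_mult power_mult_distrib E_def)
  qed
  ultimately show ?thesis by simp
qed

text \<open>Integrate \<open>cos x \<ge> 1 - x\<^sup>2/2\<close> over the arc.\<close>

lemma arc_coeff_lower_bound:
  assumes h: "0 < h"
  shows "2 * h * (1 - (2 * pi * of_int n * h)\<^sup>2 / 6) \<le> cmod (arc_coeff h n)"
proof -
  have cos_lower: "1 - x\<^sup>2 / 2 \<le> cos x" for x :: real
  proof -
    have "\<bar>sin (x / 2)\<bar>\<^sup>2 \<le> \<bar>x / 2\<bar>\<^sup>2" by (intro power_mono abs_sin_x_le_abs_x) simp
    then show ?thesis using cos_double_sin[of "x / 2"] by (simp add: power_divide)
  qed
  define w where "w = 2 * pi * of_int n"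
  have "(\<lambda>v. cis (- w * v)) integrable_on {-h..h}" by (intro integrable_continuous_real continuous_intros)
  then have "((\<lambda>v. cis (- w * v)) has_integral arc_coeff h n) {-h..h}"
    unfolding arc_coeff_def w_def using integrable_integral by fastforce
  from has_integral_linear[OF this bounded_linear_Re]
  have 1: "((\<lambda>v. cos (w * v)) has_integral Re (arc_coeff h n)) {-h..h}" by (simp add: o_def)
  have "((\<lambda>v. 1 - w\<^sup>2 * v\<^sup>2 / 2) has_integral (h - w\<^sup>2 * h ^ 3 / 6) - (-h - w\<^sup>2 * (-h) ^ 3 / 6)) {-h..h}"
    using h by (intro fundamental_theorem_of_calculus)
      (auto intro!: derivative_eq_intros simp flip: has_real_derivative_iff_has_vector_derivative)
  from has_integral_le[OF this 1]
  have "(h - w\<^sup>2 * h ^ 3 / 6) - (-h - w\<^sup>2 * (-h) ^ 3 / 6) \<le> Re (arc_coeff h n)"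
    using cos_lower[of "w * v" for v] by (simp add: power_mult_distrib)
  also have "\<dots> \<le> cmod (arc_coeff h n)" by (rule complex_Re_le_cmod)
  finally show ?thesis by (simp add: w_def power2_eq_square power3_eq_cube algebra_simps)
qed

section \<open>Chebyshev's and Mertens' estimates\<close>

abbreviation primes_upto :: "nat \<Rightarrow> nat set" where
  "primes_upto n \<equiv> {p. prime p \<and> p \<le> n}"

lemma finite_primes_upto [simp, intro]: "finite (primes_upto n)"
  by (rule finite_subset[of _ "{..n}"]) auto

lemma prod_primes_dvd:
  fixes P :: "nat set"
  assumes "finite P" "\<And>p. p \<in> P \<Longrightarrow> prime p" "\<And>p. p \<in> P \<Longrightarrow> p dvd m"
  shows "\<Prod>P dvd m"
  using assms
proof (induction P rule: finite_induct)
  case (insert p P)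
  have "coprime p (\<Prod>P)"
    by (intro prod_coprime_right primes_coprime) (use insert in auto)
  then show ?case using insert by (simp add: divides_mult)
qed simp

text \<open>Chebyshev's bound in Erdos' form: the primes in \<open>(m + 1, 2 m + 1]\<close> all divide the binomial
coefficient \<open>2 m + 1\<close> over \<open>m\<close>, which occurs twice in a row of sum \<open>2 * 4 ^ m\<close>.\<close>

lemma primorial_le: "\<Prod>(primes_upto n) \<le> 4 ^ n"
proof (induction n rule: less_induct)
  case (less n)
  consider "n \<le> 2" | "n > 2" "even n" | m where "n = 2 * m + 1" "m > 0"
  proof (cases "n \<le> 2 \<or> even n")
    case True
    then show ?thesis using that(1,2) by linarith
  next
    case False
    then obtain m where "n = 2 * m + 1" by (auto elim: oddE)
    moreover from this False have "m > 0" by auto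
    ultimately show ?thesis using that(3) by blast
  qed
  then show ?case
  proof cases
    case 1
    show ?thesis
    proof (cases "n = 2")
      case True
      have "primes_upto 2 = {2}" by (auto dest: prime_ge_2_nat)
      then show ?thesis by (simp add: True)
    next
      case False
      then have "primes_upto n = {}" using 1 by (auto dest: prime_ge_2_nat)
      then show ?thesis by (simp only: prod.empty) simp
    qed
  next
    case 2
    have "\<not> prime n" using 2 primes_dvd_imp_eq two_is_prime_nat by blast
    then have "p \<le> n \<longleftrightarrow> p \<le> n - 1" if "prime p" for p
      using that 2 by (cases "p = n") auto
    then have "primes_upto n = primes_upto (n - 1)" by blast
    then have "\<Prod>(primes_upto n) \<le> 4 ^ (n - 1)" using less[of "n - 1"] 2 by simp
    also have "\<dots> \<le> 4 ^ n" by (rule power_increasing) auto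
    finally show ?thesis .
  next
    case 3
    define Q where "Q = {p. prime p \<and> m + 1 < p \<and> p \<le> n}"
    have split: "primes_upto n = primes_upto (m + 1) \<union> Q" "primes_upto (m + 1) \<inter> Q = {}" "finite Q"
      unfolding Q_def using 3 by (auto intro: finite_subset[of _ "{..n}"])
    have "\<Prod>Q dvd (n choose m)"
    proof (rule prod_primes_dvd)
      fix p assume p: "p \<in> Q"
      then have "prime p" "p > m + 1" "p \<le> n" by (auto simp: Q_def)
      have "p dvd fact n" using \<open>prime p\<close> \<open>p \<le> n\<close> by (simp add: prime_dvd_fact_iff)
      moreover have "fact n = fact m * fact (n - m) * (n choose m)"
        using binomial_fact_lemma[of m n] 3 by simp
      moreover have "\<not> p dvd fact m" "\<not> p dvd fact (n - m)"
        using \<open>prime p\<close> \<open>p > m + 1\<close> 3 by (simp_all add: prime_dvd_fact_iff del: fact_Suc)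
      ultimately show "p dvd (n choose m)" using \<open>prime p\<close> by (simp add: prime_dvd_mult_iff)
    qed (use split in \<open>auto simp: Q_def\<close>)
    then have "\<Prod>Q \<le> n choose m" using 3 by (intro dvd_imp_le) auto
    also have "\<dots> \<le> 4 ^ m"
    proof -
      have "(n choose m) + (n choose (m + 1)) \<le> (\<Sum>k\<le>n. n choose k)"
        using 3 sum_mono2[of "{..n}" "{m, m+1}" "\<lambda>k. n choose k"] by simp
      moreover have "n choose (m + 1) = n choose m"
        using 3 binomial_symmetric[of m n] by simp
      moreover have "(\<Sum>k\<le>n. n choose k) = 2 * 4 ^ m" unfolding choose_row_sum 3(1) by (simp add: power_mult)
      ultimately show ?thesis by simp
    qed
    finally have "\<Prod>Q \<le> 4 ^ m" .
    moreover have "\<Prod>(primes_upto (m + 1)) \<le> 4 ^ (m + 1)" using less[of "m + 1"] 3 by simp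
    moreover have "\<Prod>(primes_upto n) = \<Prod>(primes_upto (m + 1)) * \<Prod>Q"
      unfolding split(1) by (rule prod.union_disjoint) (use split in auto)
    ultimately have "\<Prod>(primes_upto n) \<le> 4 ^ (m + 1) * 4 ^ m" by (simp add: mult_le_mono)
    also have "\<dots> = 4 ^ n" using 3 by (simp flip: power_add add: mult_2)
    finally show ?thesis .
  qed
qed

text \<open>The upper half of Mertens' first theorem.  Since \<open>p ^ (n div p)\<close> divides \<open>n!\<close>, which is at most \<open>n ^ n\<close>, the
sum of \<open>(n div p) * ln p\<close> is at most \<open>n * ln n\<close>; replacing \<open>n div p\<close> by \<open>n / p\<close> costs at most the sum of
\<open>ln p\<close>, which is at most \<open>n * ln 4\<close>.\<close>

lemma sum_ln_prime_div_le:
  assumes n: "n > 0"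
  shows "(\<Sum>p\<in>primes_upto n. ln (real p) / real p) \<le> ln (real n) + ln 4"
proof -
  let ?P = "primes_upto n"
  have pos: "p > 0" if "p \<in> ?P" for p using that prime_gt_0_nat by auto
  have "(\<Prod>p\<in>?P. p ^ (n div p)) dvd fact n"
  proof -
    have cop: "coprime (p ^ a) (q ^ b)" if "p \<in> ?P" "q \<in> ?P" "p \<noteq> q" for p q a b
      using that primes_coprime by auto
    have dvd: "p ^ (n div p) dvd fact n" if p: "p \<in> ?P" for p
    proof -
      have "p ^ k dvd (fact (k * p) :: nat)" for k
      proof (induction k)
        case (Suc k)
        have "p * fact (k * p) dvd (fact (Suc k * p) :: nat)"
        proof -
          obtain r where r: "Suc k * p = Suc r" "r \<ge> k * p" using pos[OF p] by (cases "Suc k * p") auto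
          have "(fact (Suc k * p) :: nat) = Suc k * p * fact r" by (simp only: r(1) fact_Suc of_nat_id)
          moreover have "(fact (k * p) :: nat) dvd fact r" using r by (intro fact_dvd) auto
          ultimately show ?thesis by (metis dvd_triv_right mult_dvd_mono)
        qed
        then show ?case using Suc by (metis dvd_trans mult_dvd_mono dvd_refl power_Suc)
      qed simp
      moreover have "fact (n div p * p) dvd (fact n :: nat)" by (intro fact_dvd) simp
      ultimately show ?thesis using dvd_trans by blast
    qed
    show ?thesis
    proof -
      have "finite A \<Longrightarrow> A \<subseteq> ?P \<Longrightarrow> (\<Prod>p\<in>A. p ^ (n div p)) dvd fact n" for A
      proof (induction A rule: finite_induct)
        case (insert q A)
        have "coprime (q ^ (n div q)) (\<Prod>p\<in>A. p ^ (n div p))"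
          by (intro prod_coprime_right cop) (use insert in auto)
        then show ?case using insert dvd by (simp add: divides_mult)
      qed simp
      then show ?thesis by simp
    qed
  qed
  then have "(\<Prod>p\<in>?P. p ^ (n div p)) \<le> fact n" by (rule dvd_imp_le) simp
  also have "\<dots> \<le> n ^ n" using fact_le_power[of n, where 'a = nat] by simp
  finally have "real (\<Prod>p\<in>?P. p ^ (n div p)) \<le> real (n ^ n)" by (simp only: of_nat_le_iff)
  then have "ln (\<Prod>p\<in>?P. real p ^ (n div p)) \<le> ln (real n ^ n)"
    using n pos by (subst ln_le_cancel_iff) (auto intro!: prod_pos)
  moreover have "ln (\<Prod>p\<in>?P. real p ^ (n div p)) = (\<Sum>p\<in>?P. real (n div p) * ln (real p))"
    by (subst ln_prod) (use pos in \<open>auto simp: ln_realpow\<close>)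
  ultimately have 1: "(\<Sum>p\<in>?P. real (n div p) * ln (real p)) \<le> real n * ln (real n)"
    using n by (simp add: ln_realpow)
  have 2: "(\<Sum>p\<in>?P. ln (real p)) \<le> real n * ln 4"
  proof -
    have "real (\<Prod>?P) \<le> real (4 ^ n)" by (simp only: of_nat_le_iff primorial_le)
    then have "ln (\<Prod>p\<in>?P. real p) \<le> ln (4 ^ n)"
      using pos by (subst ln_le_cancel_iff) (auto intro!: prod_pos)
    then show ?thesis using pos by (subst (asm) ln_prod) (auto simp: ln_realpow)
  qed
  have "real n * (\<Sum>p\<in>?P. ln (real p) / real p) = (\<Sum>p\<in>?P. real n / real p * ln (real p))"
    by (simp add: sum_distrib_left)
  also have "\<dots> \<le> (\<Sum>p\<in>?P. (real (n div p) + 1) * ln (real p))"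
  proof (intro sum_mono mult_right_mono)
    fix p assume p: "p \<in> ?P"
    have "n < (n div p + 1) * p" using dividend_less_div_times[OF pos[OF p], of n] by (simp add: algebra_simps)
    then have "real n < real ((n div p + 1) * p)" by (simp only: of_nat_less_iff)
    then show "real n / real p \<le> real (n div p) + 1" using pos[OF p] by (simp add: field_simps)
    show "0 \<le> ln (real p)" using pos[OF p] by simp
  qed
  also have "\<dots> \<le> real n * (ln (real n) + ln 4)" using 1 2 by (simp add: algebra_simps sum.distrib)
  finally show ?thesis using n by simp
qed

text \<open>A bound for the partial sums of \<open>\<zeta>(1 + \<epsilon>)\<close>.\<close>

lemma sum_inverse_powr_le:
  fixes \<epsilon> :: real
  assumes "0 < \<epsilon>"
  shows "(\<Sum>k=1..m. real k powr (- (1 + \<epsilon>))) \<le> 1 + 1 / \<epsilon>"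
proof (cases "m = 0")
  case False
  then have "1 \<le> m" by simp
  then have "(\<Sum>k=1..m. real k powr (- (1 + \<epsilon>))) \<le> 1 + (1 - real m powr - \<epsilon>) / \<epsilon>"
  \<comment> \<open>the terms are bounded by differences of \<open>- 1 / (\<epsilon> * k powr \<epsilon>)\<close>, so the sum telescopes\<close>
  proof (induction m rule: dec_induct)
    case base then show ?case by simp
  next
    case (step n)
    define x where "x = real n"
    have x: "x \<ge> 1" using step by (simp add: x_def)
    have "(x + 1) powr - (1 + \<epsilon>) * \<epsilon> \<le> x powr - \<epsilon> - (x + 1) powr - \<epsilon>"
    proof -
      have "1 / (x + 1) \<le> - ln (1 - 1 / (x + 1))"
        using ln_le_minus_one[of "1 - 1 / (x + 1)"] x by (simp add: field_simps)
      also have "1 - 1 / (x + 1) = x / (x + 1)" using x by (simp add: field_simps)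
      also have "- ln (x / (x + 1)) = ln (x + 1) - ln x" using x by (simp add: ln_div)
      finally have "\<epsilon> * (1 / (x + 1)) \<le> \<epsilon> * (ln (x + 1) - ln x)"
        using assms by (intro mult_left_mono) auto
      then have "1 + \<epsilon> * (1 / (x + 1)) \<le> 1 + \<epsilon> * (ln (x + 1) - ln x)" by simp
      also have "\<dots> \<le> exp (\<epsilon> * (ln (x + 1) - ln x))" by simp
      also have "\<dots> = x powr - \<epsilon> / (x + 1) powr - \<epsilon>"
        using x by (simp add: powr_def exp_diff [symmetric] algebra_simps)
      finally have "(1 + \<epsilon> / (x + 1)) * (x + 1) powr - \<epsilon> \<le> x powr - \<epsilon>"
        using x by (simp add: field_simps)
      moreover have "(x + 1) powr - (1 + \<epsilon>) = (x + 1) powr - \<epsilon> / (x + 1)"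
        using x powr_add[of "x + 1" "- \<epsilon>" "- 1"] by (simp add: powr_minus divide_inverse add.commute)
      ultimately show ?thesis by (simp add: algebra_simps)
    qed
    then have "(x + 1) powr - (1 + \<epsilon>) \<le> (x powr - \<epsilon> - (x + 1) powr - \<epsilon>) / \<epsilon>"
      using assms by (simp add: pos_le_divide_eq)
    then show ?case using step.IH by (simp add: x_def diff_divide_distrib add.commute)
  qed
  also have "\<dots> \<le> 1 + 1 / \<epsilon>" using assms by (simp add: divide_right_mono)
  finally show ?thesis .
qed (use assms in simp)

lemma prime_dvd_prod_primes_iff:
  fixes Q :: "nat set"
  assumes "finite Q" "\<And>p. p \<in> Q \<Longrightarrow> prime p" "prime p"
  shows "p dvd \<Prod>Q \<longleftrightarrow> p \<in> Q"
proof
  assume "p dvd \<Prod>Q"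
  then obtain q where "q \<in> Q" "p dvd q" using assms by (auto simp: prime_dvd_prod_iff)
  then show "p \<in> Q" using assms primes_dvd_imp_eq by blast
qed (use assms(1) in \<open>rule dvd_prodI\<close>)

lemma inj_on_prod_primes:
  fixes P :: "nat set"
  assumes "finite P" "\<And>p. p \<in> P \<Longrightarrow> prime p"
  shows "inj_on (\<lambda>Q. \<Prod>Q) (Pow P)"
proof (rule inj_onI)
  fix Q R assume "Q \<in> Pow P" "R \<in> Pow P" and eq: "\<Prod>Q = \<Prod>R"
  then have "finite Q" "finite R" "Q \<subseteq> P" "R \<subseteq> P" using assms(1) finite_subset by auto
  then have "p \<in> Q \<longleftrightarrow> p dvd \<Prod>Q" "p \<in> R \<longleftrightarrow> p dvd \<Prod>R" if "p \<in> P" for p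
    using prime_dvd_prod_primes_iff[of Q p] prime_dvd_prod_primes_iff[of R p] assms(2) that by blast+
  then show "Q = R" using eq \<open>Q \<subseteq> P\<close> \<open>R \<subseteq> P\<close> by auto
qed

text \<open>Expanding the product gives a sum over distinct squarefree numbers, hence a part of \<open>\<zeta>(1 + \<epsilon>)\<close>.\<close>

lemma prod_one_plus_powr_le:
  fixes P :: "nat set"
  assumes P: "finite P" "\<And>p. p \<in> P \<Longrightarrow> prime p" and "0 < \<epsilon>"
  shows "(\<Prod>p\<in>P. 1 + real p powr (- (1 + \<epsilon>))) \<le> 1 + 1 / \<epsilon>"
proof -
  let ?f = "\<lambda>k::nat. real k powr (- (1 + \<epsilon>))"
  have pos: "p > 0" if "p \<in> P" for p using P(2)[OF that] prime_gt_0_nat by blast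
  have "(\<Prod>p\<in>P. ?f p + 1) = (\<Sum>Q\<in>Pow P. (\<Prod>p\<in>Q. ?f p))"
    by (subst prod_add[OF P(1)]) simp
  also have "\<dots> = (\<Sum>Q\<in>Pow P. ?f (\<Prod>Q))"
    by (intro sum.cong refl) (simp add: prod_powr_distrib)
  also have "\<dots> = sum ?f ((\<lambda>Q. \<Prod>Q) ` Pow P)"
    by (subst sum.reindex[OF inj_on_prod_primes[OF P]]) (auto simp: o_def)
  also have "\<dots> \<le> sum ?f {1..\<Prod>P}"
  proof (rule sum_mono2)
    show "(\<lambda>Q. \<Prod>Q) ` Pow P \<subseteq> {1..\<Prod>P}"
    proof clarsimp
      fix Q assume "Q \<subseteq> P"
      then have "\<Prod>Q dvd \<Prod>P" using P(1) by (intro prod_dvd_prod_subset)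
      moreover have "\<Prod>P > 0" "\<Prod>Q > 0" using pos \<open>Q \<subseteq> P\<close> by (auto intro!: prod_pos)
      ultimately show "Suc 0 \<le> \<Prod>Q \<and> \<Prod>Q \<le> \<Prod>P" by (simp add: dvd_imp_le)
    qed
  qed auto
  also have "\<dots> \<le> 1 + 1 / \<epsilon>" by (rule sum_inverse_powr_le) fact
  finally show ?thesis by (simp add: add.commute)
qed

text \<open>Rankin's trick: shifting the exponent from \<open>1\<close> to \<open>1 + \<epsilon>\<close> with \<open>\<epsilon> = 1 / ln n\<close> makes the product comparable
with \<open>\<zeta>(1 + \<epsilon>) \<le> 1 + ln n\<close>, and changes the factor at \<open>p\<close> by at most \<open>exp (\<epsilon> * ln p / p)\<close>; by Mertens'
first theorem all these changes together amount to a bounded factor.\<close>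

lemma prod_one_plus_inverse_primes_le_Rankin:
  assumes "n \<ge> 2"
  shows "(\<Prod>p\<in>primes_upto n. 1 + 1 / real p) \<le> (1 + ln (real n)) * exp (1 + ln 4 / ln (real n))"
proof -
  define \<epsilon> where "\<epsilon> = 1 / ln (real n)"
  have L: "ln (real n) > 0" using assms by simp
  then have \<epsilon>: "\<epsilon> > 0" by (simp add: \<epsilon>_def)
  have "(\<Prod>p\<in>primes_upto n. 1 + 1 / real p)
      \<le> (\<Prod>p\<in>primes_upto n. exp (\<epsilon> * (ln (real p) / real p)) * (1 + real p powr (- (1 + \<epsilon>))))"
  proof (rule prod_mono, safe)
    fix p :: nat assume "prime p" "p \<le> n"
    then have p: "real p \<ge> 2" using prime_ge_2_nat by fastforce
    define x where "x = 1 / real p"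
    define y where "y = real p powr (- (1 + \<epsilon>))"
    have y: "y = x * real p powr - \<epsilon>"
      using p powr_add[of "real p" "- \<epsilon>" "- 1"] by (simp add: y_def x_def powr_minus divide_inverse add.commute)
    have "real p powr - \<epsilon> \<ge> 1 - \<epsilon> * ln (real p)"
      using p exp_ge_add_one_self[of "- \<epsilon> * ln (real p)"] by (simp add: powr_def)
    then have "x * (1 - \<epsilon> * ln (real p)) \<le> y" unfolding y using p by (intro mult_left_mono) (auto simp: x_def)
    then have d: "x - y \<le> \<epsilon> * (ln (real p) / real p)" by (simp add: x_def algebra_simps)
    have "real p powr - \<epsilon> \<le> real p powr 0" using p \<epsilon> by (intro powr_mono) auto
    then have yx: "0 \<le> y" "y \<le> x" using p mult_left_mono[of "real p powr - \<epsilon>" 1 x] by (auto simp: y x_def)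
    have "1 + x \<le> (1 + y) * (1 + (x - y))" using yx mult_nonneg_nonneg[of y "x - y"] by (simp add: algebra_simps)
    also have "\<dots> \<le> (1 + y) * exp (\<epsilon> * (ln (real p) / real p))"
    proof (intro mult_left_mono)
      have "1 + (x - y) \<le> exp (x - y)" by simp
      also have "\<dots> \<le> exp (\<epsilon> * (ln (real p) / real p))" using d by simp
      finally show "1 + (x - y) \<le> exp (\<epsilon> * (ln (real p) / real p))" .
    qed (use yx in auto)
    finally show "1 + 1 / real p \<le> exp (\<epsilon> * (ln (real p) / real p)) * (1 + real p powr (- (1 + \<epsilon>)))"
      by (simp add: x_def y_def mult.commute)
  qed auto
  also have "\<dots> = exp (\<epsilon> * (\<Sum>p\<in>primes_upto n. ln (real p) / real p)) * (\<Prod>p\<in>primes_upto n. 1 + real p powr (- (1 + \<epsilon>)))"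
    by (simp add: prod.distrib exp_sum sum_distrib_left)
  also have "\<dots> \<le> exp (\<epsilon> * (ln (real n) + ln 4)) * (1 + 1 / \<epsilon>)"
    using sum_ln_prime_div_le[of n] assms \<epsilon>
    by (intro mult_mono prod_one_plus_powr_le) (auto intro!: mult_left_mono prod_nonneg add_nonneg_nonneg)
  also have "\<dots> = (1 + ln (real n)) * exp (1 + ln 4 / ln (real n))"
    using L by (simp add: \<epsilon>_def field_simps)
  finally show ?thesis .
qed

text \<open>A bound of the wrong order of magnitude, but with small constants, for the small values of \<open>n\<close> at which the
previous lemma is too weak.  It treats every odd number as a prime: \<open>(1 + 1/(2 j + 1))\<^sup>2 \<le> (j + 1)/j\<close>
makes the product telescope.\<close>

lemma prod_one_plus_inverse_primes_le_sqrt: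
  assumes "n < 2 ^ Suc k"
  shows "(\<Prod>p\<in>primes_upto n. 1 + 1 / real p)\<^sup>2 \<le> 9 / 4 * 2 ^ k"
proof -
  define m where "m = 2 ^ k - (1::nat)"
  have m: "n \<le> 2 * m + 1" "real m + 1 = 2 ^ k" using assms by (auto simp: m_def of_nat_diff)
  define D where "D = (\<lambda>j. 2 * j + 1) ` {1..m}"
  have sub: "primes_upto n \<subseteq> insert 2 D"
  proof
    fix p assume "p \<in> primes_upto n"
    then have p: "prime p" "p \<le> 2 * m + 1" using m by auto
    show "p \<in> insert 2 D"
    proof (cases "p = 2")
      case False
      then have "odd p" using p(1) primes_dvd_imp_eq two_is_prime_nat by blast
      then obtain j where "p = 2 * j + 1" by (rule oddE)
      moreover have "p \<noteq> 1" using p(1) by auto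
      ultimately show ?thesis using p by (auto simp: D_def)
    qed simp
  qed
  have "2 \<noteq> 2 * j + 1" for j :: nat by presburger
  then have fin: "finite D" "2 \<notin> D" by (auto simp: D_def)
  have tele: "(\<Prod>j=1..l. 1 + 1 / real (2 * j + 1))\<^sup>2 \<le> real l + 1" for l
  proof (induction l)
    case (Suc l)
    define y where "y = real l + 2"
    have "(2 * y)\<^sup>2 * (y - 1) \<le> y * (2 * y - 1)\<^sup>2"
      by (simp add: y_def power2_eq_square algebra_simps)
    moreover have "1 + 1 / real (2 * Suc l + 1) = 2 * y / (2 * y - 1)" by (simp add: y_def field_simps)
    moreover have "2 * y - 1 > 0" by (simp add: y_def)
    ultimately have "(1 + 1 / real (2 * Suc l + 1))\<^sup>2 * (y - 1) \<le> y"
      by (simp add: power_divide pos_divide_le_eq)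
    then have "(1 + 1 / real (2 * Suc l + 1))\<^sup>2 * (real l + 1) \<le> real (Suc l) + 1"
      by (simp add: y_def add.commute)
    moreover have "(\<Prod>j=1..Suc l. 1 + 1 / real (2 * j + 1))\<^sup>2 = (1 + 1 / real (2 * Suc l + 1))\<^sup>2 * (\<Prod>j=1..l. 1 + 1 / real (2 * j + 1))\<^sup>2"
      by (simp add: power_mult_distrib mult.commute)
    ultimately show ?case using mult_left_mono[OF Suc, of "(1 + 1 / real (2 * Suc l + 1))\<^sup>2"] by simp
  qed simp
  have "(\<Prod>p\<in>primes_upto n. 1 + 1 / real p) \<le> (\<Prod>p\<in>insert 2 D. 1 + 1 / real p)"
    by (rule prod_mono2) (use sub fin in auto)
  also have "\<dots> = 3 / 2 * (\<Prod>j=1..m. 1 + 1 / real (2 * j + 1))"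
    using fin by (simp add: D_def prod.reindex inj_on_def)
  finally have "(\<Prod>p\<in>primes_upto n. 1 + 1 / real p)\<^sup>2 \<le> (3 / 2 * (\<Prod>j=1..m. 1 + 1 / real (2 * j + 1)))\<^sup>2"
    by (intro power_mono prod_nonneg) auto
  also have "\<dots> \<le> 9 / 4 * (real m + 1)" using tele[of m] by (simp add: power_mult_distrib power_divide)
  finally show ?thesis by (simp only: m)
qed

text \<open>The true order is \<open>c * ln n\<close> with \<open>c\<close> about \<open>1.08\<close>; the constant \<open>21/5\<close> is what the final numerical
bound can afford.  From \<open>n = 256\<close> on it follows from the estimate by Rankin's trick, because
\<open>ln 4 / ln n \<le> 1/4\<close> there; below, each dyadic interval is covered by the estimate over odd numbers.\<close>

lemma prod_one_plus_inverse_primes_le: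
  assumes "n \<ge> 4"
  shows "(\<Prod>p\<in>primes_upto n. 1 + 1 / real p) \<le> 21 / 5 * ln (real n)"
proof -
  let ?U = "\<Prod>p\<in>primes_upto n. 1 + 1 / real p"
  have lower: "real k * (2 / 3) \<le> ln (real n)" if "2 ^ k \<le> n" for k
  proof -
    have "real k * (2 / 3) \<le> real k * ln 2" using ln2_ge_two_thirds by (intro mult_left_mono) auto
    also have "\<dots> = ln (2 ^ k)" by (simp add: ln_realpow)
    also have "\<dots> \<le> ln (real n)"
    proof -
      have "real (2 ^ k) \<le> real n" using that by (simp only: of_nat_le_iff)
      then show ?thesis using assms by (subst ln_le_cancel_iff) auto
    qed
    finally show ?thesis .
  qed
  have small: ?thesis if k: "2 ^ k \<le> n" "n < 2 ^ Suc k" and num: "9 / 4 * 2 ^ k \<le> (14 / 5 * real k)\<^sup>2" for k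
  proof -
    have "?U\<^sup>2 \<le> (14 / 5 * real k)\<^sup>2" using prod_one_plus_inverse_primes_le_sqrt[OF k(2)] num by linarith
    then have "?U \<le> 14 / 5 * real k" by (rule power2_le_imp_le) simp
    then show ?thesis using lower[OF k(1)] by linarith
  qed
  show ?thesis
  proof (cases "n \<ge> 256")
    case True
    define L where "L = ln (real n)"
    have L: "L \<ge> 16 / 3" using lower[of 8] True by (simp add: L_def)
    have "8 * ln 2 \<le> L"
    proof -
      have "8 * ln 2 = ln ((2::real) ^ 8)" by (subst ln_realpow) auto
      also have "\<dots> \<le> L" using True unfolding L_def by (subst ln_le_cancel_iff) auto
      finally show ?thesis .
    qed
    moreover have "ln 4 = 2 * ln (2::real)" using ln_realpow[of 2 2] by simp
    ultimately have "ln 4 / L \<le> 1 / 4" using L by (simp add: pos_divide_le_eq)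
    then have "exp (1 + ln 4 / L) \<le> exp 1 * exp (1 / 4)" by (simp flip: exp_add)
    also have "\<dots> \<le> 272 / 100 * (1 + 1 / 16 + (1 / 16)\<^sup>2) ^ 4"
    proof (rule mult_mono)
      have "exp (1 / 4) = exp (1 / 16 :: real) ^ 4" by (simp flip: exp_of_nat_mult)
      also have "\<dots> \<le> (1 + 1 / 16 + (1 / 16)\<^sup>2) ^ 4" by (intro power_mono exp_bound) auto
      finally show "exp (1 / 4) \<le> (1 + 1 / 16 + (1 / 16)\<^sup>2 :: real) ^ 4" .
    qed (use e_less_272 in auto)
    finally have e: "exp (1 + ln 4 / L) \<le> 352 / 100" by (simp add: power2_eq_square power4_eq_xxxx)
    have "?U \<le> (1 + L) * exp (1 + ln 4 / L)"
      using prod_one_plus_inverse_primes_le_Rankin[of n] assms by (simp add: L_def)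
    also have "\<dots> \<le> (1 + L) * (352 / 100)" using e L by (intro mult_left_mono) auto
    also have "\<dots> \<le> 21 / 5 * L" using L by simp
    finally show ?thesis by (simp add: L_def)
  next
    case False
    obtain k where k: "2 ^ k \<le> n" "n < 2 ^ Suc k"
      using ex_power_ivl1[of 2 n] assms by auto
    have "(2::nat) ^ k < 2 ^ 8" "(2::nat) ^ 2 < 2 ^ Suc k" using k False assms by auto
    then have "k < 8" "2 < Suc k" by (simp_all only: power_strict_increasing_iff one_less_numeral_iff semiring_norm)
    then have "k \<in> {2, 3, 4, 5, 6, 7}" by auto
    then show ?thesis by (intro small[OF k]) (auto simp: power2_eq_square)
  qed
qed

section \<open>Reciprocals of squarefree numbers free of small primes\<close>

text \<open>The sum of \<open>1/q\<close> over the squarefree \<open>q \<le> z\<close> composed of primes in \<open>P\<close>, a number \<open>q\<close> being represented by the set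
\<open>Q\<close> of its prime factors.\<close>

definition sieve_sum :: "nat set \<Rightarrow> nat \<Rightarrow> real" where
  "sieve_sum P z = (\<Sum>Q | Q \<subseteq> P \<and> \<Prod>Q \<le> z. 1 / real (\<Prod>Q))"

text \<open>Split according to whether \<open>p\<close> occurs; if it does, removing it leaves a set of primes whose product is
at most \<open>z / p\<close>, in particular at most \<open>z\<close>.\<close>

lemma sieve_sum_insert:
  assumes P: "finite P" "\<And>q. q \<in> P \<Longrightarrow> prime q" and p: "prime p" "p \<notin> P"
  shows "sieve_sum (insert p P) z \<le> (1 + 1 / real p) * sieve_sum P z"
proof -
  let ?A = "{Q. Q \<subseteq> P \<and> \<Prod>Q \<le> z}" and ?B = "{Q. Q \<subseteq> P \<and> p * \<Prod>Q \<le> z}"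
  have fin: "finite ?A" "finite ?B" using P(1) by auto
  have finsub: "finite Q" if "Q \<subseteq> P" for Q using that P(1) finite_subset by blast
  have p1: "p \<ge> 1" using p(1) prime_gt_0_nat by (simp add: Suc_leI)
  have split: "{Q. Q \<subseteq> insert p P \<and> \<Prod>Q \<le> z} = ?A \<union> insert p ` ?B"
  proof (intro equalityI subsetI)
    fix Q assume "Q \<in> {Q. Q \<subseteq> insert p P \<and> \<Prod>Q \<le> z}"
    then have Q: "Q \<subseteq> insert p P" "\<Prod>Q \<le> z" by auto
    show "Q \<in> ?A \<union> insert p ` ?B"
    proof (cases "p \<in> Q")
      case True
      have "finite Q" using Q P(1) finite_subset by auto
      then have "\<Prod>Q = p * \<Prod>(Q - {p})" using True by (rule prod.remove)
      then have "Q - {p} \<in> ?B" using Q by auto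
      then show ?thesis using insert_Diff[OF True] by blast
    qed (use Q in auto)
  next
    fix Q assume "Q \<in> ?A \<union> insert p ` ?B"
    then show "Q \<in> {Q. Q \<subseteq> insert p P \<and> \<Prod>Q \<le> z}"
    proof
      assume "Q \<in> insert p ` ?B"
      then obtain R where R: "Q = insert p R" "R \<subseteq> P" "p * \<Prod>R \<le> z" by auto
      then have "p \<notin> R" "finite R" using p finsub by auto
      then show ?thesis using R by auto
    qed auto
  qed
  have "sieve_sum (insert p P) z = (\<Sum>Q\<in>?A. 1 / real (\<Prod>Q)) + (\<Sum>Q\<in>insert p ` ?B. 1 / real (\<Prod>Q))"
    unfolding sieve_sum_def split using fin p(2) by (intro sum.union_disjoint) auto
  also have "(\<Sum>Q\<in>insert p ` ?B. 1 / real (\<Prod>Q)) = (\<Sum>Q\<in>?B. 1 / real (\<Prod>(insert p Q)))"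
    by (subst sum.reindex) (use p in \<open>auto simp: inj_on_def o_def\<close>)
  also have "\<dots> = (\<Sum>Q\<in>?B. 1 / real p * (1 / real (\<Prod>Q)))"
  proof (intro sum.cong refl)
    fix Q assume "Q \<in> ?B"
    then have "p \<notin> Q" "finite Q" using p finsub by auto
    then show "1 / real (\<Prod>(insert p Q)) = 1 / real p * (1 / real (\<Prod>Q))" by simp
  qed
  also have "\<dots> = 1 / real p * (\<Sum>Q\<in>?B. 1 / real (\<Prod>Q))" by (simp add: sum_distrib_left)
  also have "\<dots> \<le> 1 / real p * (\<Sum>Q\<in>?A. 1 / real (\<Prod>Q))"
  proof (intro mult_left_mono sum_mono2 fin)
    show "?B \<subseteq> ?A" 
    proof clarsimp
      fix Q assume "p * \<Prod>Q \<le> z"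
      moreover have "\<Prod>Q \<le> p * \<Prod>Q" using mult_le_mono1[OF p1, of "\<Prod>Q"] by (simp only: mult_1_left)
      ultimately show "\<Prod>Q \<le> z" by (rule order_trans[rotated])
    qed
  qed (auto intro: prod_nonneg)
  finally show ?thesis by (simp add: sieve_sum_def algebra_simps)
qed

lemma sieve_sum_nonneg: "0 \<le> sieve_sum P z"
  unfolding sieve_sum_def by (intro sum_nonneg) (simp flip: of_nat_prod)

lemma sieve_sum_Un:
  assumes "finite A" "finite P" "\<And>q. q \<in> A \<union> P \<Longrightarrow> prime q" "A \<inter> P = {}"
  shows "sieve_sum (A \<union> P) z \<le> (\<Prod>p\<in>A. 1 + 1 / real p) * sieve_sum P z"
  using assms
proof (induction A rule: finite_induct)
  case (insert p A)
  have "sieve_sum (insert p (A \<union> P)) z \<le> (1 + 1 / real p) * sieve_sum (A \<union> P) z"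
    using insert by (intro sieve_sum_insert) auto
  also have "\<dots> \<le> (1 + 1 / real p) * ((\<Prod>p\<in>A. 1 + 1 / real p) * sieve_sum P z)"
    using insert by (intro mult_left_mono) auto
  finally show ?case using insert by (simp add: mult.assoc)
qed simp

text \<open>The constant is close to \<open>\<zeta>(2) = 1.6449...\<close>: from \<open>d = 4\<close> on the terms are compared with the telescoping
\<open>1/(d - 1/2) - 1/(d + 1/2)\<close>.\<close>

lemma sum_inverse_squares_le: "(\<Sum>d=1..m. 1 / (real d)\<^sup>2) \<le> 1647 / 1000"
proof -
  have "(\<Sum>d=1..m. 1 / (real d)\<^sup>2) \<le> (\<Sum>d=1..m + 3. 1 / (real d)\<^sup>2)"
    by (intro sum_mono2) auto
  also have "\<dots> \<le> 1647 / 1000 - 1 / (real (m + 3) + 1 / 2)"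
  proof (induction m)
    case 0
    then show ?case by (simp add: numeral_eq_Suc)
  next
    case (Suc m)
    define y where "y = real (m + 4)"
    have y2: "y \<ge> 1" by (simp add: y_def)
    then have "y\<^sup>2 \<ge> 1" by (rule one_le_power)
    then have y: "y\<^sup>2 > 1 / 4" by linarith
    have "1 / y\<^sup>2 \<le> 1 / (y\<^sup>2 - 1 / 4)" using y by (intro divide_left_mono mult_pos_pos) auto
    also have "y\<^sup>2 - 1 / 4 = (y - 1 / 2) * (y + 1 / 2)" by (simp add: power2_eq_square algebra_simps)
    also have "1 / ((y - 1 / 2) * (y + 1 / 2)) = 1 / (y - 1 / 2) - 1 / (y + 1 / 2)"
      using y2 by (simp add: diff_frac_eq)
    finally have "1 / (real (m + 4))\<^sup>2 \<le> 1 / (real (m + 3) + 1 / 2) - 1 / (real (m + 4) + 1 / 2)"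
      by (simp add: y_def)
    moreover have "Suc m + 3 = Suc (m + 3)" by simp
    ultimately show ?case using Suc by (simp only: sum.cl_ivl_Suc) (simp add: algebra_simps)
  qed
  also have "\<dots> \<le> 1647 / 1000" by simp
  finally show ?thesis .
qed

text \<open>Euler's \<open>\<zeta>(2) = pi\<^sup>2/6\<close> turns the same bound into a numerical bound for \<open>pi\<close>.\<close>

lemma pi_squared_le: "pi\<^sup>2 \<le> 9882 / 1000"
proof -
  have "pi\<^sup>2 / 6 \<le> 1647 / 1000"
  proof (rule LIMSEQ_le_const2)
    show "(\<lambda>n. \<Sum>i<n. 1 / (real i + 1)\<^sup>2) \<longlonglongrightarrow> pi\<^sup>2 / 6"
      using inverse_squares_sums by (simp add: sums_def add.commute)
  next
    have "(\<Sum>i<n. 1 / (real i + 1)\<^sup>2) \<le> 1647 / 1000" for n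
    proof -
    have "(\<Sum>i<n. 1 / (real i + 1)\<^sup>2) = (\<Sum>d=1..n. 1 / (real d)\<^sup>2)"
      by (simp add: sum.atLeast1_atMost_eq add.commute)
    then show ?thesis using sum_inverse_squares_le by simp
    qed
    then show "\<exists>N. \<forall>n\<ge>N. (\<Sum>i<n. 1 / (real i + 1)\<^sup>2) \<le> 1647 / 1000" by blast
  qed
  then show ?thesis by simp
qed

lemma prod_prime_factors_squarefree:
  fixes n :: nat
  assumes "squarefree n"
  shows "\<Prod>(prime_factors n) = n"
proof -
  have "n > 0" using assms by (auto intro: gr0I)
  then have "n = (\<Prod>p\<in>prime_factors n. p ^ multiplicity p n)" by (rule prime_factorization_nat)
  also have "\<dots> = \<Prod>(prime_factors n)"
  proof (rule prod.cong[OF refl])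
    fix p assume p: "p \<in> prime_factors n"
    then have "multiplicity p n \<ge> 1" using \<open>n > 0\<close> by (auto simp: prime_factors_multiplicity)
    moreover have "multiplicity p n \<le> 1"
      using assms p by (auto simp: squarefree_factorial_semiring'' in_prime_factors_iff)
    ultimately show "p ^ multiplicity p n = p" by simp
  qed
  finally show ?thesis ..
qed

text \<open>Writing \<open>n \<le> z\<close> as a squarefree number times a square bounds the harmonic sum by the sum over
squarefree numbers times the sum of the inverse squares.\<close>

lemma ln_le_sieve_sum_primes_upto: "ln (real z + 1) \<le> 1647 / 1000 * sieve_sum (primes_upto z) z"
proof -
  let ?A = "{Q. Q \<subseteq> primes_upto z \<and> \<Prod>Q \<le> z}"
  let ?g = "\<lambda>n::nat. (prime_factors (squarefree_part n), square_part n)"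
  have finA: "finite ?A" by simp
  have decomp: "n = \<Prod>(prime_factors (squarefree_part n)) * square_part n ^ 2" for n :: nat
    by (simp only: prod_prime_factors_squarefree squarefree_squarefree_part squarefree_decompose [symmetric])
  have inj: "inj_on ?g {1..z}"
  proof (rule inj_onI)
    fix m n assume "?g m = ?g n"
    then show "m = n" using decomp[of m] decomp[of n] by (simp only: prod.inject)
  qed
  have sub: "?g ` {1..z} \<subseteq> ?A \<times> {1..z}"
  proof clarify
    fix n assume n: "n \<in> {1..z}"
    have "squarefree_part n dvd n" "square_part n dvd n"
      using dvd_triv_left[of "squarefree_part n" "square_part n ^ 2"]
        dvd_triv_right[of "square_part n" "squarefree_part n * square_part n"]
      by (simp_all only: mult.assoc power2_eq_square [symmetric] squarefree_decompose [symmetric])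
    then have le: "squarefree_part n \<le> z" "square_part n \<le> z"
      using n by (auto dest!: dvd_imp_le)
    have "prime_factors (squarefree_part n) \<subseteq> primes_upto z"
    proof
      fix p assume "p \<in> prime_factors (squarefree_part n)"
      then have "prime p" "p dvd squarefree_part n" by (auto simp: in_prime_factors_iff)
      moreover from this have "p \<le> squarefree_part n" by (intro dvd_imp_le) (simp_all add: zero_less_iff_neq_zero)
      ultimately show "p \<in> primes_upto z" using le(1) by simp
    qed
    moreover have "\<Prod>(prime_factors (squarefree_part n)) \<le> z"
      using le(1) by (simp only: prod_prime_factors_squarefree squarefree_squarefree_part)
    moreover have "square_part n \<noteq> 0" using n by simp
    then have "square_part n \<ge> 1" by linarith
    ultimately show "prime_factors (squarefree_part n) \<in> ?A \<and> square_part n \<in> {1..z}"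
      using le by simp
  qed
  let ?F = "\<lambda>(Q, d). 1 / real (\<Prod>Q) * (1 / (real d)\<^sup>2)"
  have "ln (real z + 1) \<le> (\<Sum>n=1..z. 1 / real n)"
    using ln_le_harm[of z] by (simp add: harm_def inverse_eq_divide)
  also have "\<dots> = (\<Sum>n=1..z. ?F (?g n))"
  proof (intro sum.cong refl)
    fix n assume "n \<in> {1..z}"
    have "real n = real (\<Prod>(prime_factors (squarefree_part n))) * (real (square_part n))\<^sup>2"
      by (subst decomp[of n]) (simp only: of_nat_mult of_nat_power)
    then have "1 / real n = 1 / (real (\<Prod>(prime_factors (squarefree_part n))) * (real (square_part n))\<^sup>2)"
      by (rule arg_cong)
    then show "1 / real n = ?F (?g n)" by (simp only: case_prod_conv times_divide_times_eq mult_1_left)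
  qed
  also have "\<dots> = sum ?F (?g ` {1..z})"
    unfolding sum.reindex[OF inj] by (simp only: o_def)
  also have "\<dots> \<le> sum ?F (?A \<times> {1..z})"
  proof (rule sum_mono2[OF _ sub])
    show "finite (?A \<times> {1..z})" using finA by simp
  qed (auto intro!: divide_nonneg_nonneg mult_nonneg_nonneg prod_nonneg)
  also have "\<dots> = sieve_sum (primes_upto z) z * (\<Sum>d=1..z. 1 / (real d)\<^sup>2)"
    by (simp add: sieve_sum_def sum_product sum.cartesian_product)
  also have "\<dots> \<le> sieve_sum (primes_upto z) z * (1647 / 1000)"
    by (intro mult_left_mono sum_inverse_squares_le sieve_sum_nonneg)
  finally show ?thesis by (simp add: mult.commute)
qed

lemma sieve_sum_lower_bound:
  assumes r: "r \<ge> 4"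
  shows "ln (real z + 1) \<le> 1647 / 1000 * (21 / 5 * ln (real r)) * sieve_sum {p. prime p \<and> r < p \<and> p \<le> z} z"
proof -
  let ?P = "{p. prime p \<and> r < p \<and> p \<le> z}"
  let ?A = "{p. prime p \<and> p \<le> min r z}"
  have fin: "finite ?P" by (rule finite_subset[of _ "{..z}"]) auto
  have "sieve_sum (?A \<union> ?P) z \<le> (\<Prod>p\<in>?A. 1 + 1 / real p) * sieve_sum ?P z"
    by (rule sieve_sum_Un) (use fin in auto)
  moreover have "?A \<union> ?P = primes_upto z" by auto
  ultimately have "sieve_sum (primes_upto z) z \<le> (\<Prod>p\<in>?A. 1 + 1 / real p) * sieve_sum ?P z"
    by (simp only:)
  also have "(\<Prod>p\<in>?A. 1 + 1 / real p) \<le> (\<Prod>p\<in>primes_upto r. 1 + 1 / real p)"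
    by (rule prod_mono2) auto
  also have "\<dots> \<le> 21 / 5 * ln (real r)" by (rule prod_one_plus_inverse_primes_le[OF r])
  finally have "sieve_sum (primes_upto z) z \<le> 21 / 5 * ln (real r) * sieve_sum ?P z"
    using sieve_sum_nonneg by (simp only: mult_right_mono)
  then show ?thesis using ln_le_sieve_sum_primes_upto[of z] by simp
qed

section \<open>An analytic large sieve inequality\<close>

text \<open>Bessel's inequality for arcs of length \<open>1/(2N)\<close>.  After a translation of the interval to one centred at
\<open>0\<close> its frequencies have absolute value at most \<open>N/2\<close>, so that the Fourier coefficients of the arc are within a
constant factor of its length.  Arcs of length \<open>1/N\<close> would cost a worse factor there;
with \<open>1/(2N)\<close>, at most \<open>1 + 1/(N * \<delta>)\<close> points of a well spaced set are at distance less than the arc length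
from a given one, and the final bound is a multiple of \<open>N + 1/\<delta>\<close>.\<close>

lemma large_sieve_overlap:
  fixes c :: "'j \<Rightarrow> complex" and t :: "'j \<Rightarrow> real" and S :: "nat set"
  assumes J: "finite J" and N: "N \<ge> 1" and S: "finite S" "\<And>n. n \<in> S \<Longrightarrow> M + 1 \<le> real n \<and> real n \<le> M + N"
  shows "(\<Sum>n\<in>S. (cmod (\<Sum>j\<in>J. c j * cis (2 * pi * real n * t j)))\<^sup>2)
     \<le> 2486 / 1000 * N * (\<Sum>j\<in>J. \<Sum>k\<in>J. if dist_nearest_int (t j - t k) < 1 / (2 * N) then cmod (c j) * cmod (c k) else 0)"
    (is "?L \<le> _ * ?W")
proof -
  define h where "h = 1 / (4 * N)"
  have h: "0 < h" "h \<le> 1 / 2" "2 * h = 1 / (2 * N)" using N by (auto simp: h_def field_simps)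
  define n0 where "n0 = round (M + (N + 1) / 2)"
  have "\<bar>real_of_int n0 - (M + (N + 1) / 2)\<bar> \<le> 1 / 2"
    unfolding n0_def by (rule of_int_round_abs_le)
  then have "real_of_int n0 \<le> M + N / 2 + 1" "M + N / 2 \<le> real_of_int n0"
    unfolding abs_le_iff add_divide_distrib by linarith+
  then have n0: "\<bar>of_int (n0 - int n)\<bar> \<le> N / 2" if "n \<in> S" for n
    using S(2)[OF that, THEN conjunct1] S(2)[OF that, THEN conjunct2]
    unfolding abs_le_iff of_int_diff of_int_of_nat_eq by linarith
  define m where "m n = n0 - int n" for n
  \<comment> \<open>the translation \<open>n = n0 - m n\<close> is absorbed by the coefficients\<close>
  define d where "d j = c j * cis (2 * pi * of_int n0 * t j)" for j
  have coeff: "2 * h * (897 / 1000) \<le> cmod (arc_coeff h (m n))" if "n \<in> S" for n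
  proof -
    have "\<bar>2 * pi * of_int (m n) * h\<bar> = 2 * pi * h * \<bar>of_int (m n)\<bar>" using h by (simp add: abs_mult)
    also have "\<dots> \<le> 2 * pi * h * (N / 2)" using n0[OF that] h by (intro mult_left_mono) (auto simp: m_def)
    also have "\<dots> = pi / 4" using N by (simp add: h_def)
    finally have "\<bar>2 * pi * of_int (m n) * h\<bar>\<^sup>2 \<le> (pi / 4)\<^sup>2" by (intro power_mono) auto
    also have "\<dots> \<le> 6 * (103 / 1000)" using pi_squared_le by (simp add: power_divide)
    finally have "897 / 1000 \<le> 1 - (2 * pi * of_int (m n) * h)\<^sup>2 / 6" by simp
    then have "2 * h * (897 / 1000) \<le> 2 * h * (1 - (2 * pi * of_int (m n) * h)\<^sup>2 / 6)"
      using h(1) by (intro mult_left_mono) auto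
    also have "\<dots> \<le> cmod (arc_coeff h (m n))" by (rule arc_coeff_lower_bound) fact
    finally show ?thesis .
  qed
  have inj: "inj_on m S" by (auto simp: inj_on_def m_def)
  have "(2 * h * (897 / 1000))\<^sup>2 * ?L
      = (\<Sum>n\<in>S. (2 * h * (897 / 1000))\<^sup>2 * (cmod (\<Sum>j\<in>J. d j * cis (- 2 * pi * of_int (m n) * t j)))\<^sup>2)"
  proof -
    have "c j * cis (2 * pi * real n * t j) = d j * cis (- 2 * pi * of_int (m n) * t j)" for j n
      by (simp add: d_def m_def mult.assoc cis_mult) (simp add: algebra_simps)
    then show ?thesis by (simp add: sum_distrib_left)
  qed
  also have "\<dots> \<le> (\<Sum>n\<in>S. (cmod (arc_coeff h (m n)))\<^sup>2 * (cmod (\<Sum>j\<in>J. d j * cis (- 2 * pi * of_int (m n) * t j)))\<^sup>2)"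
    using h(1) by (intro sum_mono mult_right_mono power_mono coeff) auto
  also have "\<dots> = (\<Sum>i\<in>m ` S. (cmod (arc_coeff h i))\<^sup>2 * (cmod (\<Sum>j\<in>J. d j * cis (- 2 * pi * of_int i * t j)))\<^sup>2)"
    by (subst sum.reindex[OF inj]) (simp only: o_def)
  also have "\<dots> \<le> 2 * h * (\<Sum>j\<in>J. \<Sum>k\<in>J. if dist_nearest_int (t j - t k) < 2 * h then cmod (d j) * cmod (d k) else 0)"
    by (rule bessel_arcs[OF h(1,2) J]) (use S in auto)
  also have "\<dots> = 2 * h * ?W" unfolding h(3) by (simp only: d_def norm_mult norm_cis mult_1_right)
  finally have "2 * h * (2 * h * (897 / 1000)\<^sup>2 * ?L) \<le> 2 * h * ?W"
    by (simp only: power2_eq_square mult_ac)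
  then have 1: "2 * h * (897 / 1000)\<^sup>2 * ?L \<le> ?W"
    using h(1) by (subst (asm) mult_le_cancel_left_pos) simp_all
  have "?L = 2 * N / (897 / 1000)\<^sup>2 * (2 * h * (897 / 1000)\<^sup>2 * ?L)"
    using N by (simp add: h(3))
  also have "\<dots> \<le> 2 * N / (897 / 1000)\<^sup>2 * ?W" using 1 N by (intro mult_left_mono) auto
  also have "\<dots> \<le> 2486 / 1000 * N * ?W"
    using N by (intro mult_right_mono sum_nonneg) (auto simp: power2_eq_square)
  finally show ?thesis .
qed

section \<open>Fractions with squarefree denominators\<close>

text \<open>The reduced fractions \<open>a/q\<close> modulo \<open>1\<close>, for \<open>q = \<Prod>Q\<close> squarefree, correspond to the families of nonzero residues
\<open>x p\<close> modulo \<open>p\<close>, \<open>p \<in> Q\<close>, by partial fractions: \<open>a/q = (\<Sum>p\<in>Q. x p / p)\<close>.  With this encoding Ramanujan sums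
factor without any appeal to the Chinese remainder theorem.\<close>

definition sieve_points :: "nat set \<Rightarrow> nat \<Rightarrow> (nat set \<times> (nat \<Rightarrow> nat)) set" where
  "sieve_points P z = (SIGMA Q:{Q. Q \<subseteq> P \<and> \<Prod>Q \<le> z}. PiE Q (\<lambda>p. {1..<p}))"

definition sieve_frac :: "nat set \<times> (nat \<Rightarrow> nat) \<Rightarrow> real" where
  "sieve_frac j = (\<Sum>p\<in>fst j. real (snd j p) / real p)"

definition sieve_weight :: "nat set \<times> (nat \<Rightarrow> nat) \<Rightarrow> real" where
  "sieve_weight j = 1 / real (\<Prod>(fst j))"

text \<open>The Ramanujan sum modulo a prime.\<close>

lemma sum_cis_multiples:
  assumes p: "prime p" and n: "\<not> p dvd n"
  shows "(\<Sum>j\<in>{1..<p}. cis (2 * pi * real n * (real j / real p))) = - 1"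
proof -
  define w where "w = cis (2 * pi * real n / real p)"
  have p0: "p > 0" using p prime_gt_0_nat by blast
  have pow: "cis (2 * pi * real n * (real j / real p)) = w ^ j" for j
    by (simp add: w_def Complex.DeMoivre mult_ac)
  have "w \<noteq> 1"
  proof
    assume "w = 1"
    then obtain k :: int where "2 * pi * real n / real p = of_int k * (2 * pi)"
      unfolding w_def cis_conv_exp exp_eq_1 by auto
    then have "real n = of_int k * real p" using p0 by (simp add: field_simps)
    then have "int n = k * int p" by (metis of_int_eq_iff of_int_mult of_int_of_nat_eq)
    then show False using n by (metis dvd_triv_right int_dvd_int_iff)
  qed
  moreover have "w ^ p = 1"
    using p0 cis_multiple_2pi[of "real n"] by (simp add: w_def Complex.DeMoivre)
  ultimately have "(\<Sum>j<p. w ^ j) = 0" by (simp add: geometric_sum)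
  moreover have "{..<p} = insert 0 {1..<p}" using p0 by auto
  ultimately have "(\<Sum>j\<in>{1..<p}. w ^ j) = - 1" by (simp add: eq_neg_iff_add_eq_0 add.commute)
  then show ?thesis by (simp only: pow)
qed

lemma cis_sum: "cis (\<Sum>x\<in>A. f x) = (\<Prod>x\<in>A. cis (f x))"
  by (induction A rule: infinite_finite_induct) (simp_all flip: cis_mult)

locale prime_sieve =
  fixes P :: "nat set" and z :: nat
  assumes finP: "finite P" and primeP: "\<And>p. p \<in> P \<Longrightarrow> prime p"
begin

lemma finite_subset_P: "Q \<subseteq> P \<Longrightarrow> finite Q"
  using finP finite_subset by blast

lemma finite_sieve_points: "finite (sieve_points P z)"
  unfolding sieve_points_def using finP finite_subset_P
  by (intro finite_SigmaI finite_PiE) auto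

lemma prod_pos_P: "Q \<subseteq> P \<Longrightarrow> \<Prod>Q > 0"
  using primeP prime_gt_0_nat by (intro prod_pos) auto

text \<open>The inner sum over the points with denominator \<open>\<Prod>Q\<close> is the Ramanujan sum, which factors into the contributions
\<open>- 1\<close> of the primes in \<open>Q\<close>.  The sign in the coefficient cancels it, so the whole sum is the same for
all \<open>n\<close> that are not divisible by a prime in \<open>P\<close>.\<close>

lemma sieve_identity:
  assumes n: "\<And>p. p \<in> P \<Longrightarrow> \<not> p dvd n"
  shows "(\<Sum>j\<in>sieve_points P z. of_real ((- 1) ^ card (fst j) * sieve_weight j) * cis (2 * pi * real n * sieve_frac j))
       = of_real (sieve_sum P z)"
proof -
  have "(\<Sum>x\<in>PiE Q (\<lambda>p. {1..<p}). cis (2 * pi * real n * sieve_frac (Q, x))) = (- 1) ^ card Q" if Q: "Q \<subseteq> P" for Q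
  proof -
    have "(\<Sum>x\<in>PiE Q (\<lambda>p. {1..<p}). cis (2 * pi * real n * sieve_frac (Q, x)))
        = (\<Sum>x\<in>PiE Q (\<lambda>p. {1..<p}). \<Prod>p\<in>Q. cis (2 * pi * real n * (real (x p) / real p)))"
      by (simp only: sieve_frac_def fst_conv snd_conv sum_distrib_left cis_sum)
    also have "\<dots> = (\<Prod>p\<in>Q. \<Sum>j\<in>{1..<p}. cis (2 * pi * real n * (real j / real p)))"
      by (rule prod_sum_PiE[symmetric]) (use finite_subset_P[OF Q] in auto)
    also have "\<dots> = (\<Prod>p\<in>Q. - 1)"
      using Q n primeP by (intro prod.cong refl sum_cis_multiples) auto
    finally show ?thesis by simp
  qed
  note inner = this
  have "(\<Sum>j\<in>sieve_points P z. of_real ((- 1) ^ card (fst j) * sieve_weight j) * cis (2 * pi * real n * sieve_frac j))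
      = (\<Sum>Q | Q \<subseteq> P \<and> \<Prod>Q \<le> z. \<Sum>x\<in>PiE Q (\<lambda>p. {1..<p}).
            of_real ((- 1) ^ card Q / real (\<Prod>Q)) * cis (2 * pi * real n * sieve_frac (Q, x)))"
    unfolding sieve_points_def
    by (subst sum.Sigma) (use finP finite_subset_P in \<open>auto intro!: finite_PiE sum.cong simp: sieve_weight_def split_beta\<close>)
  also have "\<dots> = (\<Sum>Q | Q \<subseteq> P \<and> \<Prod>Q \<le> z. of_real (1 / real (\<Prod>Q)))"
  proof (intro sum.cong refl)
    fix Q assume "Q \<in> {Q. Q \<subseteq> P \<and> \<Prod>Q \<le> z}"
    then have Q: "Q \<subseteq> P" by auto
    have "(- 1) ^ card Q * (- 1) ^ card Q = (1 :: complex)" by (simp flip: power_mult_distrib)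
    then show "(\<Sum>x\<in>PiE Q (\<lambda>p. {1..<p}). of_real ((- 1) ^ card Q / real (\<Prod>Q)) * cis (2 * pi * real n * sieve_frac (Q, x)))
        = of_real (1 / real (\<Prod>Q))"
      by (simp only: sum_distrib_left [symmetric] inner[OF Q]) simp
  qed
  finally show ?thesis by (simp add: sieve_sum_def)
qed

text \<open>There are at most \<open>q\<close> points with denominator \<open>q\<close>, each with squared weight \<open>1/q\<^sup>2\<close>.\<close>

lemma sum_sieve_weight_sq:
  assumes p: "A \<subseteq> {Q. Q \<subseteq> P \<and> \<Prod>Q \<le> z}"
  shows "(\<Sum>j | j \<in> sieve_points P z \<and> fst j \<in> A. (sieve_weight j)\<^sup>2) \<le> (\<Sum>Q\<in>A. 1 / real (\<Prod>Q))"
proof -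
  have finA: "finite A" using p finP by (auto intro: finite_subset)
  have "{j. j \<in> sieve_points P z \<and> fst j \<in> A} = (SIGMA Q:A. PiE Q (\<lambda>p. {1..<p}))"
    using p unfolding sieve_points_def by fastforce
  then have "(\<Sum>j | j \<in> sieve_points P z \<and> fst j \<in> A. (sieve_weight j)\<^sup>2)
      = (\<Sum>Q\<in>A. \<Sum>x\<in>PiE Q (\<lambda>p. {1..<p}). (1 / real (\<Prod>Q))\<^sup>2)"
    by (subst sum.Sigma) (use finA p finite_subset_P in \<open>auto intro!: finite_PiE sum.cong simp: sieve_weight_def split_beta\<close>)
  also have "\<dots> \<le> (\<Sum>Q\<in>A. 1 / real (\<Prod>Q))"
  proof (rule sum_mono)
    fix Q assume "Q \<in> A"
    then have Q: "Q \<subseteq> P" using p by auto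
    have "card (PiE Q (\<lambda>p. {1..<p})) = (\<Prod>p\<in>Q. p - 1)"
      using finite_subset_P[OF Q] by (simp add: card_PiE)
    also have "\<dots> \<le> \<Prod>Q" by (intro prod_mono) auto
    finally have "real (card (PiE Q (\<lambda>p. {1..<p}))) \<le> real (\<Prod>Q)" by (simp only: of_nat_le_iff)
    then have "real (card (PiE Q (\<lambda>p. {1..<p}))) * (1 / real (\<Prod>Q))\<^sup>2 \<le> real (\<Prod>Q) * (1 / real (\<Prod>Q))\<^sup>2"
      by (intro mult_right_mono) auto
    also have "\<dots> = 1 / real (\<Prod>Q)" using prod_pos_P[OF Q] by (simp add: power2_eq_square)
    finally show "(\<Sum>x\<in>PiE Q (\<lambda>p. {1..<p}). (1 / real (\<Prod>Q))\<^sup>2) \<le> 1 / real (\<Prod>Q)" by simp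
  qed
  finally show ?thesis .
qed

lemma sum_sieve_weight_sq_all: "(\<Sum>j\<in>sieve_points P z. (sieve_weight j)\<^sup>2) \<le> sieve_sum P z"
proof -
  have "{j. j \<in> sieve_points P z \<and> fst j \<in> {Q. Q \<subseteq> P \<and> \<Prod>Q \<le> z}} = sieve_points P z"
    by (auto simp: sieve_points_def)
  then show ?thesis using sum_sieve_weight_sq[of "{Q. Q \<subseteq> P \<and> \<Prod>Q \<le> z}"] by (simp add: sieve_sum_def)
qed

text \<open>The factor \<open>1/p\<close> is the source of the gain for far pairs: a denominator divisible by \<open>p\<close> is \<open>p\<close> times
another admissible denominator.\<close>

lemma sum_sieve_weight_sq_prime:
  assumes p: "p \<in> P"
  shows "(\<Sum>j | j \<in> sieve_points P z \<and> p \<in> fst j. (sieve_weight j)\<^sup>2) \<le> sieve_sum P z / real p"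
proof -
  let ?A = "{Q. Q \<subseteq> P \<and> \<Prod>Q \<le> z}"
  let ?Ap = "{Q. Q \<subseteq> P \<and> \<Prod>Q \<le> z \<and> p \<in> Q}"
  have p0: "p > 0" using p primeP prime_gt_0_nat by blast
  have prod: "\<Prod>Q = p * \<Prod>(Q - {p})" if "Q \<in> ?Ap" for Q
    using that finite_subset_P[of Q] by (intro prod.remove) auto
  have "{j. j \<in> sieve_points P z \<and> fst j \<in> ?Ap} = {j. j \<in> sieve_points P z \<and> p \<in> fst j}"
    by (auto simp: sieve_points_def)
  then have "(\<Sum>j | j \<in> sieve_points P z \<and> p \<in> fst j. (sieve_weight j)\<^sup>2) \<le> (\<Sum>Q\<in>?Ap. 1 / real (\<Prod>Q))"
    using sum_sieve_weight_sq[of ?Ap] by (simp only:) auto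
  also have "\<dots> = (\<Sum>Q\<in>?Ap. 1 / real (\<Prod>(Q - {p})) / real p)"
    by (intro sum.cong refl) (simp only: prod of_nat_mult divide_divide_eq_left mult.commute)
  also have "\<dots> = (\<Sum>Q\<in>(\<lambda>Q. Q - {p}) ` ?Ap. 1 / real (\<Prod>Q)) / real p"
  proof -
    have "inj_on (\<lambda>Q. Q - {p}) ?Ap" by (auto simp: inj_on_def)
    then show ?thesis by (simp only: sum.reindex o_def sum_divide_distrib)
  qed
  also have "\<dots> \<le> sieve_sum P z / real p"
    unfolding sieve_sum_def
  proof (intro divide_right_mono sum_mono2)
    show "(\<lambda>Q. Q - {p}) ` ?Ap \<subseteq> ?A"
    proof clarify
      fix Q assume Q: "Q \<subseteq> P" "\<Prod>Q \<le> z" "p \<in> Q"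
      then have "\<Prod>Q = p * \<Prod>(Q - {p})" by (intro prod) auto
      moreover have "\<Prod>(Q - {p}) \<le> p * \<Prod>(Q - {p})" using p0 by (cases p) auto
      ultimately have "\<Prod>(Q - {p}) \<le> z" using Q(2) by linarith
      then show "Q - {p} \<subseteq> P \<and> \<Prod>(Q - {p}) \<le> z" using Q by auto
    qed
  qed (use finP in \<open>auto intro: prod_nonneg\<close>)
  finally show ?thesis .
qed

text \<open>The partial fraction coordinate at \<open>p\<close>, with the value \<open>0\<close> at primes that are not in the denominator.  It
allows points with different denominators to be compared over the common index set \<open>P\<close>.\<close>

definition sieve_val :: "nat set \<times> (nat \<Rightarrow> nat) \<Rightarrow> nat \<Rightarrow> int" where
  "sieve_val j p = (if p \<in> fst j then int (snd j p) else 0)"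

text \<open>Uniqueness of partial fractions modulo \<open>1\<close>: multiply by \<open>\<Prod>P\<close> and reduce modulo \<open>q\<close>; only the term of index
\<open>q\<close> survives, with a factor coprime to \<open>q\<close>.\<close>

lemma sum_fractions_int_imp_dvd:
  fixes c :: "nat \<Rightarrow> int"
  assumes int: "(\<Sum>p\<in>P. of_int (c p) / real p) \<in> \<int>" and q: "q \<in> P"
  shows "int q dvd c q"
proof -
  obtain k :: int where k: "(\<Sum>p\<in>P. of_int (c p) / real p) = of_int k"
    using int by (rule Ints_cases)
  have p0: "p > 0" if "p \<in> P" for p using primeP[OF that] prime_gt_0_nat by blast
  have "of_int (k * int (\<Prod>P)) = (\<Sum>p\<in>P. of_int (c p) / real p * real (\<Prod>P))"
    by (simp add: k [symmetric] sum_distrib_right)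
  also have "\<dots> = (\<Sum>p\<in>P. of_int (c p * int (\<Prod>(P - {p}))))"
  proof (intro sum.cong refl)
    fix p assume p: "p \<in> P"
    have "real (\<Prod>P) = real p * real (\<Prod>(P - {p}))"
      using prod.remove[OF finP p, of "\<lambda>p. p"] by (simp only: of_nat_mult)
    then show "of_int (c p) / real p * real (\<Prod>P) = of_int (c p * int (\<Prod>(P - {p})))"
      using p0[OF p] by simp
  qed
  finally have "k * int (\<Prod>P) = (\<Sum>p\<in>P. c p * int (\<Prod>(P - {p})))"
    by (simp only: of_int_sum [symmetric] of_int_eq_iff)
  also have "\<dots> = c q * int (\<Prod>(P - {q})) + (\<Sum>p\<in>P - {q}. c p * int (\<Prod>(P - {p})))"
    by (rule sum.remove[OF finP q])
  finally have eq: "c q * int (\<Prod>(P - {q})) = k * int (\<Prod>P) - (\<Sum>p\<in>P - {q}. c p * int (\<Prod>(P - {p})))"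
    by simp
  have "int q dvd k * int (\<Prod>P)" using dvd_prodI[OF finP q, of "\<lambda>p. p"] by (intro dvd_mult) (simp only: int_dvd_int_iff)
  moreover have "int q dvd (\<Sum>p\<in>P - {q}. c p * int (\<Prod>(P - {p})))"
  proof (intro dvd_sum dvd_mult)
    fix p assume "p \<in> P - {q}"
    then have "q dvd \<Prod>(P - {p})" using dvd_prodI[of "P - {p}" q "\<lambda>p. p"] q finP by auto
    then show "int q dvd int (\<Prod>(P - {p}))" by (simp only: int_dvd_int_iff)
  qed
  ultimately have "int q dvd c q * int (\<Prod>(P - {q}))" unfolding eq by (rule dvd_diff)
  moreover have "coprime (int q) (int (\<Prod>(P - {q})))"
  proof -
    have "coprime q (\<Prod>(P - {q}))"
      using primeP q by (intro prod_coprime_right primes_coprime) auto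
    then show ?thesis by (simp only: coprime_int_iff)
  qed
  ultimately show ?thesis by (simp only: coprime_dvd_mult_left_iff)
qed

lemma sieve_frac_eq: "j \<in> sieve_points P z \<Longrightarrow> sieve_frac j = (\<Sum>p\<in>P. of_int (sieve_val j p) / real p)"
  unfolding sieve_frac_def sieve_val_def
  by (rule sum.mono_neutral_cong_left) (use finP in \<open>auto simp: sieve_points_def\<close>)

lemma sieve_val_bounds:
  assumes "j \<in> sieve_points P z" "p \<in> P"
  shows "0 \<le> sieve_val j p" "sieve_val j p < int p" "p \<in> fst j \<longleftrightarrow> sieve_val j p \<noteq> 0"
proof -
  have "snd j \<in> PiE (fst j) (\<lambda>p. {1..<p})" using assms(1) by (auto simp: sieve_points_def)
  then have "snd j p \<in> {1..<p}" if "p \<in> fst j" using that by (rule PiE_mem)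
  moreover have "p > 0" using primeP[OF assms(2)] by (rule prime_gt_0_nat)
  ultimately show "0 \<le> sieve_val j p" "sieve_val j p < int p" "p \<in> fst j \<longleftrightarrow> sieve_val j p \<noteq> 0"
    by (cases "p \<in> fst j"; simp add: sieve_val_def)+
qed

lemma sieve_frac_inject:
  assumes j: "j \<in> sieve_points P z" and k: "k \<in> sieve_points P z" and int: "sieve_frac j - sieve_frac k \<in> \<int>"
  shows "j = k"
proof -
  have eq: "sieve_val j p = sieve_val k p" if p: "p \<in> P" for p
  proof -
    have "(\<Sum>p\<in>P. of_int (sieve_val j p - sieve_val k p) / real p) = sieve_frac j - sieve_frac k"
      by (simp add: sieve_frac_eq[OF j] sieve_frac_eq[OF k] diff_divide_distrib sum_subtractf)
    then have "int p dvd sieve_val j p - sieve_val k p"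
      using int p by (intro sum_fractions_int_imp_dvd) (simp only:)
    then have "sieve_val j p mod int p = sieve_val k p mod int p" by (simp add: mod_eq_dvd_iff)
    then show ?thesis using sieve_val_bounds[OF j p] sieve_val_bounds[OF k p] by simp
  qed
  have sub: "fst j \<subseteq> P" "fst k \<subseteq> P" using j k by (auto simp: sieve_points_def)
  then have fst: "fst j = fst k"
  proof -
    have "p \<in> fst j \<longleftrightarrow> p \<in> fst k" if "p \<in> P" for p
      using eq[OF that] sieve_val_bounds(3)[OF j that] sieve_val_bounds(3)[OF k that] by simp
    then show ?thesis using sub by blast
  qed
  moreover have "snd j = snd k"
  proof (rule PiE_ext)
    show "snd j \<in> PiE (fst j) (\<lambda>p. {1..<p})" "snd k \<in> PiE (fst j) (\<lambda>p. {1..<p})"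
      using j k fst by (auto simp: sieve_points_def)
    fix p assume "p \<in> fst j"
    then show "snd j p = snd k p" using eq[of p] sub fst by (auto simp: sieve_val_def)
  qed
  ultimately show ?thesis by (rule prod_eqI)
qed

lemma sieve_frac_denominator:
  assumes j: "j \<in> sieve_points P z"
  shows "real (\<Prod>(fst j)) * sieve_frac j \<in> \<int>"
proof -
  have sub: "fst j \<subseteq> P" using j by (auto simp: sieve_points_def)
  have "real (\<Prod>(fst j)) * (real (snd j p) / real p) \<in> \<int>" if p: "p \<in> fst j" for p
  proof -
    have "real (\<Prod>(fst j)) = real p * real (\<Prod>(fst j - {p}))"
      using prod.remove[OF finite_subset_P[OF sub] p, of "\<lambda>p. p"] by (simp only: of_nat_mult)
    moreover have "p > 0" using p sub primeP prime_gt_0_nat by blast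
    ultimately have "real (\<Prod>(fst j)) * (real (snd j p) / real p) = real (\<Prod>(fst j - {p}) * snd j p)"
      by simp
    then show ?thesis by (simp only: Ints_of_nat)
  qed
  then show ?thesis unfolding sieve_frac_def sum_distrib_left by (rule Ints_sum)
qed

lemma sieve_point_denominator_bounds:
  assumes j: "j \<in> sieve_points P z"
  shows "1 \<le> \<Prod>(fst j)" "\<Prod>(fst j) \<le> z"
  using j prod_pos_P[of "fst j"] by (auto simp: sieve_points_def Suc_le_eq)

end

lemma near_integer_denominator:
  fixes t :: real and q :: nat
  assumes q: "q > 0" "real q * t \<in> \<int>" and d: "dist_nearest_int t < 1 / real q"
  shows "t \<in> \<int>"
proof -
  obtain k :: int where k: "dist_nearest_int t = \<bar>t - of_int k\<bar>"
    using dist_nearest_int_attained by blast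
  obtain l :: int where l: "real q * t = of_int l" using q(2) by (rule Ints_cases)
  have "real q * \<bar>t - of_int k\<bar> < 1" using d q(1) unfolding k by (simp add: field_simps)
  also have "real q * \<bar>t - of_int k\<bar> = \<bar>of_int (l - int q * k)\<bar>"
  proof -
    have "of_int (l - int q * k) = real q * (t - of_int k)" using l by (simp add: algebra_simps)
    then show ?thesis by (simp add: abs_mult)
  qed
  finally have "l = int q * k" by linarith
  then have "t = of_int k" using l q(1) by simp
  then show ?thesis by simp
qed

section \<open>Matchings and well spaced points\<close>

text \<open>If \<open>R\<close> is a partial matching, the weighted arithmetic-geometric mean inequality bounds the sum over matched pairs by
sums of squares; every index is used at most once.  The parameter \<open>l\<close> balances two sums of different size.\<close>

lemma sum_matching_le:
  fixes u v :: "'a \<Rightarrow> real"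
  assumes fin: "finite A" "finite B" and l: "l > 0"
    and R: "\<And>j k k'. j \<in> A \<Longrightarrow> k \<in> B \<Longrightarrow> k' \<in> B \<Longrightarrow> R j k \<Longrightarrow> R j k' \<Longrightarrow> k = k'"
           "\<And>j j' k. j \<in> A \<Longrightarrow> j' \<in> A \<Longrightarrow> k \<in> B \<Longrightarrow> R j k \<Longrightarrow> R j' k \<Longrightarrow> j = j'"
  shows "(\<Sum>j\<in>A. \<Sum>k\<in>B. if R j k then u j * v k else 0) \<le> (l * (\<Sum>j\<in>A. (u j)\<^sup>2) + (\<Sum>k\<in>B. (v k)\<^sup>2) / l) / 2"
proof -
  have amgm: "u j * v k \<le> l * (u j)\<^sup>2 / 2 + (v k)\<^sup>2 / l / 2" for j k
  proof -
    have "0 \<le> (l * u j - v k)\<^sup>2 / (2 * l)" using l by simp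
    also have "\<dots> = l * (u j)\<^sup>2 / 2 + (v k)\<^sup>2 / l / 2 - u j * v k"
      using l by (simp add: power2_eq_square field_simps)
    finally show ?thesis by simp
  qed
  have one: "(\<Sum>x\<in>X. if T x then c else 0) \<le> c"
    if "finite X" "c \<ge> 0" and T: "\<And>x y. x \<in> X \<Longrightarrow> y \<in> X \<Longrightarrow> T x \<Longrightarrow> T y \<Longrightarrow> x = y" for X :: "'a set" and T and c :: real
  proof -
    have "card {x\<in>X. T x} \<le> 1" using T that(1) by (auto simp: card_le_Suc0_iff_eq)
    then have "real (card {x\<in>X. T x}) * c \<le> 1 * c" using that(2) by (intro mult_right_mono) auto
    then show ?thesis using that(1) by (simp add: sum.If_cases Int_def)
  qed
  have "(\<Sum>j\<in>A. \<Sum>k\<in>B. if R j k then u j * v k else 0)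
      \<le> (\<Sum>j\<in>A. \<Sum>k\<in>B. (if R j k then l * (u j)\<^sup>2 / 2 else 0) + (if R j k then (v k)\<^sup>2 / l / 2 else 0))"
    by (intro sum_mono) (use amgm in auto)
  also have "\<dots> = (\<Sum>j\<in>A. \<Sum>k\<in>B. if R j k then l * (u j)\<^sup>2 / 2 else 0) + (\<Sum>k\<in>B. \<Sum>j\<in>A. if R j k then (v k)\<^sup>2 / l / 2 else 0)"
    by (simp only: sum.distrib) (subst sum.swap[of _ B A], rule refl)
  also have "\<dots> \<le> (\<Sum>j\<in>A. l * (u j)\<^sup>2 / 2) + (\<Sum>k\<in>B. (v k)\<^sup>2 / l / 2)"
    using l fin R by (intro add_mono sum_mono one) auto
  also have "\<dots> = (l * (\<Sum>j\<in>A. (u j)\<^sup>2) + (\<Sum>k\<in>B. (v k)\<^sup>2) / l) / 2"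
    by (simp add: sum_distrib_left sum_divide_distrib add_divide_distrib)
  finally show ?thesis .
qed

lemma card_separated_le:
  fixes V :: "real set"
  assumes "finite V" "V \<noteq> {}" "V \<subseteq> {a..b}" and sep: "\<And>v w. v \<in> V \<Longrightarrow> w \<in> V \<Longrightarrow> v \<noteq> w \<Longrightarrow> d \<le> \<bar>v - w\<bar>"
  shows "(real (card V) - 1) * d \<le> b - a"
  using assms
proof (induction V arbitrary: b rule: finite_linorder_max_induct)
  case (insert w V)
  show ?case
  proof (cases "V = {}")
    case False
    have "V \<subseteq> {a..b - d}"
    proof
      fix v assume v: "v \<in> V"
      then have "v < w" using insert by auto
      moreover have "d \<le> \<bar>v - w\<bar>" using insert.prems(3)[of v w] v \<open>v < w\<close> by auto
      ultimately show "v \<in> {a..b - d}" using insert.prems(2) v by auto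
    qed
    then have "(real (card V) - 1) * d \<le> b - d - a"
      using insert.IH[of "b - d"] insert.prems(3) False by auto
    moreover have "card (insert w V) = card V + 1" using insert by auto
    ultimately show ?thesis by (simp add: algebra_simps)
  qed (use insert in auto)
qed simp

text \<open>The points of \<open>B\<close> at distance less than \<open>r\<close> from \<open>x\<close> modulo \<open>1\<close> have representatives in an interval of length
\<open>2 r\<close>, and these are still separated by \<open>d\<close>.\<close>

lemma card_near_le:
  fixes \<beta> :: "'b \<Rightarrow> real"
  assumes fin: "finite B" and d: "d > 0" and r: "r \<ge> 0"
    and sep: "\<And>b b'. b \<in> B \<Longrightarrow> b' \<in> B \<Longrightarrow> b \<noteq> b' \<Longrightarrow> d \<le> dist_nearest_int (\<beta> b - \<beta> b')"
  shows "real (card {b\<in>B. dist_nearest_int (\<beta> b - x) < r}) * d \<le> d + 2 * r"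
proof (cases "{b\<in>B. dist_nearest_int (\<beta> b - x) < r} = {}")
  case True
  then show ?thesis using d r by (simp only: card.empty)
next
  case False
  let ?A = "{b\<in>B. dist_nearest_int (\<beta> b - x) < r}"
  have "\<forall>b. \<exists>k::int. dist_nearest_int (\<beta> b - x) = \<bar>\<beta> b - x - of_int k\<bar>"
    using dist_nearest_int_attained by blast
  then obtain k :: "'b \<Rightarrow> int" where k: "\<And>b. dist_nearest_int (\<beta> b - x) = \<bar>\<beta> b - x - of_int (k b)\<bar>"
    by metis
  define v where "v b = \<beta> b - x - of_int (k b)" for b
  have sepv: "d \<le> \<bar>v b - v b'\<bar>" if "b \<in> B" "b' \<in> B" "b \<noteq> b'" for b b'
  proof -
    have "d \<le> dist_nearest_int (\<beta> b - \<beta> b')" by (rule sep) fact+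
    also have "\<dots> \<le> \<bar>\<beta> b - \<beta> b' - of_int (k b - k b')\<bar>" by (rule dist_nearest_int_le)
    also have "\<dots> = \<bar>v b - v b'\<bar>" by (simp add: v_def algebra_simps)
    finally show ?thesis .
  qed
  then have inj: "inj_on v ?A" using d by (force simp: inj_on_def)
  have "(real (card (v ` ?A)) - 1) * d \<le> r - (- r)"
  proof (rule card_separated_le)
    show "v ` ?A \<subseteq> {- r..r}" using k by (auto simp: v_def abs_less_iff)
  qed (use fin False sepv in auto)
  then show ?thesis by (simp add: card_image[OF inj] algebra_simps)
qed

section \<open>Correlation of the sieve fractions\<close>

text \<open>The total weight of the overlaps between the sieve fractions translated by \<open>\<tau>\<close> and the sieve fractions; it is applied
with \<open>\<tau> = b - b'\<close>.\<close>

definition correlation :: "nat set \<Rightarrow> nat \<Rightarrow> real \<Rightarrow> real \<Rightarrow> real" where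
  "correlation P z \<eta> \<tau> = (\<Sum>j\<in>sieve_points P z. \<Sum>k\<in>sieve_points P z.
      if dist_nearest_int (\<tau> + sieve_frac j - sieve_frac k) < \<eta> then sieve_weight j * sieve_weight k else 0)"

lemma sieve_weight_nonneg: "0 \<le> sieve_weight j"
  by (simp add: sieve_weight_def prod_nonneg)

context prime_sieve
begin

context
  fixes \<eta> :: real
  assumes z: "z \<ge> 1" and \<eta>: "2 * \<eta> \<le> 1 / real (z ^ 4)"
begin

private abbreviation "X \<equiv> sieve_points P z"

private definition near :: "real \<Rightarrow> nat set \<times> (nat \<Rightarrow> nat) \<Rightarrow> nat set \<times> (nat \<Rightarrow> nat) \<Rightarrow> bool" where
  "near \<tau> j k \<longleftrightarrow> dist_nearest_int (\<tau> + sieve_frac j - sieve_frac k) < \<eta>"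

text \<open>The two differences are close to each other modulo \<open>1\<close>, and four denominators, each at most \<open>z\<close>, are too small
to separate them; this is where \<open>z ^ 4\<close> enters.\<close>

private lemma diff_int:
  assumes "j \<in> X" "k \<in> X" "j' \<in> X" "k' \<in> X" and near: "near \<tau> j k" "near \<tau> j' k'"
  shows "(sieve_frac j - sieve_frac k) - (sieve_frac j' - sieve_frac k') \<in> \<int>"
proof -
  let ?q = "\<lambda>j :: nat set \<times> (nat \<Rightarrow> nat). \<Prod>(fst j)"
  let ?D = "?q j * ?q k * (?q j' * ?q k')"
  note bounds = sieve_point_denominator_bounds
  have den: "real (?q j) * sieve_frac j \<in> \<int>" if "j \<in> X" for j
    using sieve_frac_denominator[OF that] .
  have D: "?D > 0" "?D \<le> z ^ 4"
  proof -
    have "?q j > 0" if "j \<in> X" for j using bounds(1)[OF that] by linarith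
    then show "?D > 0" using assms(1-4) by (simp only: nat_0_less_mult_iff simp_thms)
    have "?D \<le> z * z * (z * z)" by (intro mult_le_mono bounds(2) assms)
    then show "?D \<le> z ^ 4" by (simp only: power4_eq_xxxx mult.assoc)
  qed
  show ?thesis
  proof (rule near_integer_denominator[OF D(1)])
    have "real ?D * ((sieve_frac j - sieve_frac k) - (sieve_frac j' - sieve_frac k'))
        = real (?q k * (?q j' * ?q k')) * (real (?q j) * sieve_frac j)
        - real (?q j * (?q j' * ?q k')) * (real (?q k) * sieve_frac k)
        - (real (?q j * ?q k * ?q k') * (real (?q j') * sieve_frac j')
           - real (?q j * ?q k * ?q j') * (real (?q k') * sieve_frac k'))"
      by (simp only: of_nat_mult) algebra
    also have "\<dots> \<in> \<int>"
      by (intro Ints_diff Ints_mult[OF Ints_of_nat] den assms)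
    finally show "real ?D * ((sieve_frac j - sieve_frac k) - (sieve_frac j' - sieve_frac k')) \<in> \<int>" .
    have "(sieve_frac j - sieve_frac k) - (sieve_frac j' - sieve_frac k')
        = (\<tau> + sieve_frac j - sieve_frac k) - (\<tau> + sieve_frac j' - sieve_frac k')" by simp
    then have "dist_nearest_int ((sieve_frac j - sieve_frac k) - (sieve_frac j' - sieve_frac k'))
        \<le> dist_nearest_int (\<tau> + sieve_frac j - sieve_frac k) + dist_nearest_int (\<tau> + sieve_frac j' - sieve_frac k')"
      by (simp only: dist_nearest_int_triangle_diff)
    also have "\<dots> < 2 * \<eta>" using near unfolding near_def by linarith
    also have "2 * \<eta> \<le> 1 / real (z ^ 4)" by (rule \<eta>)
    also have "\<dots> \<le> 1 / real ?D" using D by (intro frac_le) (simp_all only: of_nat_le_iff of_nat_0_less_iff zero_le_one order_refl)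
    finally show "dist_nearest_int ((sieve_frac j - sieve_frac k) - (sieve_frac j' - sieve_frac k')) < 1 / real ?D" .
  qed
qed

private lemma near_matching:
  assumes "j \<in> X" "k \<in> X" "k' \<in> X"
  shows "near \<tau> j k \<Longrightarrow> near \<tau> j k' \<Longrightarrow> k = k'" "near \<tau> k j \<Longrightarrow> near \<tau> k' j \<Longrightarrow> k = k'"
proof -
  assume "near \<tau> j k" "near \<tau> j k'"
  from diff_int[OF assms(1,2) assms(1,3) this] have "sieve_frac k' - sieve_frac k \<in> \<int>" by simp
  then show "k = k'" using sieve_frac_inject[OF assms(3,2)] by simp
next
  assume "near \<tau> k j" "near \<tau> k' j"
  from diff_int[OF assms(2,1) assms(3,1) this] have "sieve_frac k - sieve_frac k' \<in> \<int>" by simp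
  then show "k = k'" using sieve_frac_inject[OF assms(2,3)] by simp
qed

private lemma fin: "finite X"
  by (rule finite_sieve_points)

lemma correlation_le: "correlation P z \<eta> \<tau> \<le> sieve_sum P z"
proof -
  have "correlation P z \<eta> \<tau> = (\<Sum>j\<in>X. \<Sum>k\<in>X. if near \<tau> j k then sieve_weight j * sieve_weight k else 0)"
    by (simp add: correlation_def near_def)
  also have "\<dots> \<le> (1 * (\<Sum>j\<in>X. (sieve_weight j)\<^sup>2) + (\<Sum>k\<in>X. (sieve_weight k)\<^sup>2) / 1) / 2"
    by (rule sum_matching_le[OF fin fin]) (simp, (blast intro: near_matching)+)
  also have "\<dots> \<le> sieve_sum P z" using sum_sieve_weight_sq_all by simp
  finally show ?thesis .
qed

text \<open>All near pairs have the same difference modulo \<open>1\<close>, and as \<open>\<tau>\<close> is far from \<open>0\<close> it is not an integer.  So it has a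
nonzero coordinate at some prime \<open>p \<in> P\<close>, and in every near pair one of the two denominators is
divisible by this \<open>p\<close>.  The matching bound between all points and those with denominator divisible
by \<open>p\<close>, balanced with \<open>sqrt p\<close>, gives the saving.\<close>

lemma correlation_far_le:
  assumes far: "\<eta> \<le> dist_nearest_int \<tau>" and y: "y > 0" "\<And>p. p \<in> P \<Longrightarrow> y\<^sup>2 < real p"
  shows "correlation P z \<eta> \<tau> \<le> 2 * sieve_sum P z / y"
proof (cases "\<exists>j\<in>X. \<exists>k\<in>X. near \<tau> j k")
  case False
  then have "correlation P z \<eta> \<tau> = 0"
    unfolding correlation_def near_def by (intro sum.neutral ballI) auto
  then show ?thesis using sieve_sum_nonneg[of P z] y(1) by simp
next
  case True
  then obtain j0 k0 where 0: "j0 \<in> X" "k0 \<in> X" "near \<tau> j0 k0" by blast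
  note val = sieve_val_bounds
  note frac = sieve_frac_eq
  have "j0 \<noteq> k0" using 0(3) far by (auto simp: near_def)
  have "\<exists>p\<in>P. sieve_val j0 p \<noteq> sieve_val k0 p"
  proof (rule ccontr)
    assume "\<not> ?thesis"
    then have "sieve_frac j0 = sieve_frac k0"
      unfolding frac[OF 0(1)] frac[OF 0(2)] by (intro sum.cong) auto
    then show False using sieve_frac_inject[OF 0(1,2)] \<open>j0 \<noteq> k0\<close> by simp
  qed
  then obtain p where p: "p \<in> P" "sieve_val j0 p \<noteq> sieve_val k0 p" by blast
  have dvd: "p \<in> fst j \<or> p \<in> fst k" if jk: "j \<in> X" "k \<in> X" "near \<tau> j k" for j k
  proof (rule ccontr)
    assume "\<not> ?thesis"
    then have zero: "sieve_val j p = 0" "sieve_val k p = 0"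
      using val(3)[OF jk(1) p(1)] val(3)[OF jk(2) p(1)] by auto
    have "(\<Sum>p\<in>P. of_int ((sieve_val j p - sieve_val k p) - (sieve_val j0 p - sieve_val k0 p)) / real p)
        = (sieve_frac j - sieve_frac k) - (sieve_frac j0 - sieve_frac k0)"
      unfolding frac[OF jk(1)] frac[OF jk(2)] frac[OF 0(1)] frac[OF 0(2)]
      by (simp add: diff_divide_distrib sum_subtractf)
    moreover have "(sieve_frac j - sieve_frac k) - (sieve_frac j0 - sieve_frac k0) \<in> \<int>"
      using diff_int[OF jk(1,2) 0(1,2) jk(3) 0(3)] .
    ultimately have "int p dvd (sieve_val j p - sieve_val k p) - (sieve_val j0 p - sieve_val k0 p)"
      using sum_fractions_int_imp_dvd[OF _ p(1),
          of "\<lambda>p. (sieve_val j p - sieve_val k p) - (sieve_val j0 p - sieve_val k0 p)"] by simp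
    then have "int p dvd sieve_val k0 p - sieve_val j0 p" by (simp add: zero)
    then have "sieve_val k0 p mod int p = sieve_val j0 p mod int p" by (simp add: mod_eq_dvd_iff)
    then show False
      using p val(1,2)[OF 0(1) p(1)] val(1,2)[OF 0(2) p(1)] by simp
  qed
  define Xp where "Xp = {j. j \<in> X \<and> p \<in> fst j}"
  have Xp: "finite Xp" "Xp \<subseteq> X" using fin by (auto simp: Xp_def)
  let ?c = "\<lambda>j k. if near \<tau> j k then sieve_weight j * sieve_weight k else 0"
  have c0: "0 \<le> ?c j k" for j k using sieve_weight_nonneg by simp
  define G where "G = sieve_sum P z"
  have G: "G \<ge> 0" by (simp add: G_def sieve_sum_nonneg)
  have yp: "y < sqrt (real p)" using y p(1) by (simp add: real_less_rsqrt)
  define s where "s = sqrt (real p)"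
  have "p > 0" using primeP[OF p(1)] by (rule prime_gt_0_nat)
  then have s: "s > 0" "real p = s\<^sup>2" using yp y(1) by (simp_all add: s_def)
  have sqX: "(\<Sum>j\<in>X. (sieve_weight j)\<^sup>2) \<le> G" unfolding G_def by (rule sum_sieve_weight_sq_all)
  have sqXp: "(\<Sum>j\<in>Xp. (sieve_weight j)\<^sup>2) \<le> G / s\<^sup>2"
    unfolding G_def Xp_def s(2) [symmetric] by (rule sum_sieve_weight_sq_prime[OF p(1)])
  have "correlation P z \<eta> \<tau> = (\<Sum>j\<in>X. \<Sum>k\<in>X. ?c j k)"
    by (simp add: correlation_def near_def)
  also have "\<dots> \<le> (\<Sum>j\<in>X. \<Sum>k\<in>X. (if j \<in> Xp then ?c j k else 0) + (if k \<in> Xp then ?c j k else 0))"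
  proof (intro sum_mono)
    fix j k assume "j \<in> X" "k \<in> X"
    then show "?c j k \<le> (if j \<in> Xp then ?c j k else 0) + (if k \<in> Xp then ?c j k else 0)"
      using c0[of j k] dvd[of j k] by (auto simp: Xp_def)
  qed
  also have "\<dots> = (\<Sum>j\<in>Xp. \<Sum>k\<in>X. ?c j k) + (\<Sum>j\<in>X. \<Sum>k\<in>Xp. ?c j k)"
  proof -
    have "(\<Sum>j\<in>X. \<Sum>k\<in>X. if j \<in> Xp then ?c j k else 0) = (\<Sum>j\<in>X. if j \<in> Xp then \<Sum>k\<in>X. ?c j k else 0)"
      by (intro sum.cong refl) auto
    also have "\<dots> = (\<Sum>j\<in>Xp. \<Sum>k\<in>X. ?c j k)"
      using fin Xp(2) by (simp only: sum.inter_restrict [symmetric] Int_absorb1)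
    finally have 1: "(\<Sum>j\<in>X. \<Sum>k\<in>X. if j \<in> Xp then ?c j k else 0) = (\<Sum>j\<in>Xp. \<Sum>k\<in>X. ?c j k)" .
    have 2: "(\<Sum>j\<in>X. \<Sum>k\<in>X. if k \<in> Xp then ?c j k else 0) = (\<Sum>j\<in>X. \<Sum>k\<in>Xp. ?c j k)"
      using fin Xp(2) by (simp only: sum.inter_restrict [symmetric] Int_absorb1)
    show ?thesis by (simp only: sum.distrib 1 2)
  qed
  also have "\<dots> \<le> (s * (\<Sum>j\<in>Xp. (sieve_weight j)\<^sup>2) + (\<Sum>j\<in>X. (sieve_weight j)\<^sup>2) / s) / 2
      + (1 / s * (\<Sum>j\<in>X. (sieve_weight j)\<^sup>2) + (\<Sum>j\<in>Xp. (sieve_weight j)\<^sup>2) / (1 / s)) / 2"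
  proof (rule add_mono)
    show "(\<Sum>j\<in>Xp. \<Sum>k\<in>X. ?c j k) \<le> (s * (\<Sum>j\<in>Xp. (sieve_weight j)\<^sup>2) + (\<Sum>j\<in>X. (sieve_weight j)\<^sup>2) / s) / 2"
      using s(1) by (rule sum_matching_le[OF Xp(1) fin]) (use Xp(2) in \<open>blast intro: near_matching\<close>)+
    have "1 / s > 0" using s(1) by simp
    then show "(\<Sum>j\<in>X. \<Sum>k\<in>Xp. ?c j k) \<le> (1 / s * (\<Sum>j\<in>X. (sieve_weight j)\<^sup>2) + (\<Sum>j\<in>Xp. (sieve_weight j)\<^sup>2) / (1 / s)) / 2"
      by (rule sum_matching_le[OF fin Xp(1)]) (use Xp(2) in \<open>blast intro: near_matching\<close>)+
  qed
  also have "\<dots> = s * (\<Sum>j\<in>Xp. (sieve_weight j)\<^sup>2) + (\<Sum>j\<in>X. (sieve_weight j)\<^sup>2) / s"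
    using s(1) by (simp add: field_simps)
  also have "\<dots> \<le> s * (G / s\<^sup>2) + G / s"
    using s(1) sqX sqXp by (intro add_mono mult_left_mono divide_right_mono) auto
  also have "\<dots> = 2 * G / s" using s(1) by (simp add: power2_eq_square)
  also have "\<dots> \<le> 2 * G / y" using G y(1) yp \<open>p > 0\<close> by (intro divide_left_mono mult_pos_pos) (auto simp: s_def)
  finally show ?thesis by (simp add: G_def)
qed

end

end

section \<open>The large sieve for sifted integers\<close>

lemma sieve_sum_ge_1:
  assumes "finite P" "z \<ge> 1"
  shows "1 \<le> sieve_sum P z"
proof -
  have "(\<Sum>Q\<in>{{}}. 1 / real (\<Prod>Q)) \<le> sieve_sum P z"
    unfolding sieve_sum_def using assms by (intro sum_mono2) (auto intro: prod_nonneg)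
  then show ?thesis by simp
qed

text \<open>The sieve identity replaces the exponential sum over \<open>B\<close> by one over all \<open>b + a/q\<close>.  The overlaps of these points
are grouped by pairs \<open>(b, b')\<close>: near pairs have correlation at most \<open>G\<close> and are few since \<open>B\<close> is well
spaced, far pairs have correlation at most \<open>2 G / y\<close> and contribute the term with the square of the
\<open>1\<close>-norm.  With \<open>P = {}\<close> this is a form of the usual large sieve inequality.\<close>

lemma large_sieve_sifted:
  fixes f :: "'b \<Rightarrow> complex" and \<beta> :: "'b \<Rightarrow> real" and P S :: "nat set" and z :: nat
  assumes P: "finite P" "\<And>p. p \<in> P \<Longrightarrow> prime p" and z: "z \<ge> 1" "real (z ^ 4) \<le> N"
    and y: "y > 0" "\<And>p. p \<in> P \<Longrightarrow> y\<^sup>2 < real p"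
    and B: "finite B" and \<delta>: "\<delta> > 0"
    and sep: "\<And>b b'. b \<in> B \<Longrightarrow> b' \<in> B \<Longrightarrow> b \<noteq> b' \<Longrightarrow> \<delta> \<le> dist_nearest_int (\<beta> b - \<beta> b')"
    and S: "finite S" "\<And>n. n \<in> S \<Longrightarrow> M + 1 \<le> real n \<and> real n \<le> M + N"
      "\<And>n p. n \<in> S \<Longrightarrow> p \<in> P \<Longrightarrow> \<not> p dvd n"
  shows "sieve_sum P z * (\<Sum>n\<in>S. (cmod (\<Sum>b\<in>B. f b * cis (2 * pi * real n * \<beta> b)))\<^sup>2)
     \<le> 2486 / 1000 * ((N + 1 / \<delta>) * (\<Sum>b\<in>B. (cmod (f b))\<^sup>2) + 2 * N / y * (\<Sum>b\<in>B. cmod (f b))\<^sup>2)"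
proof -
  interpret prime_sieve P z using P by unfold_locales
  define G where "G = sieve_sum P z"
  define X where "X = sieve_points P z"
  define \<eta> where "\<eta> = 1 / (2 * N)"
  have N: "N \<ge> 1" using z by (metis of_nat_1 of_nat_le_iff one_le_power order_trans)
  have G: "G \<ge> 1" unfolding G_def by (rule sieve_sum_ge_1[OF P(1) z(1)])
  have finX: "finite X" unfolding X_def by (rule finite_sieve_points)
  have "1 / N \<le> 1 / real (z ^ 4)" using z N by (intro divide_left_mono) auto
  then have \<eta>: "2 * \<eta> \<le> 1 / real (z ^ 4)" by (simp add: \<eta>_def)
  let ?F2 = "\<Sum>b\<in>B. (cmod (f b))\<^sup>2" and ?F1 = "\<Sum>b\<in>B. cmod (f b)"
  let ?T = "\<lambda>n. \<Sum>b\<in>B. f b * cis (2 * pi * real n * \<beta> b)"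
  define c where "c = (\<lambda>(b, j). f b * of_real ((- 1) ^ card (fst j) * sieve_weight j))"
  define t where "t = (\<lambda>(b, j). \<beta> b + sieve_frac j)"
  have cmodc: "cmod (c (b, j)) = cmod (f b) * sieve_weight j" for b j
    by (simp add: c_def norm_mult norm_power sieve_weight_nonneg)
  have twist: "of_real G * ?T n = (\<Sum>i\<in>B \<times> X. c i * cis (2 * pi * real n * t i))" if "n \<in> S" for n
  proof -
    have "of_real G * ?T n = (\<Sum>b\<in>B. f b * cis (2 * pi * real n * \<beta> b)) *
        (\<Sum>j\<in>X. of_real ((- 1) ^ card (fst j) * sieve_weight j) * cis (2 * pi * real n * sieve_frac j))"
      using sieve_identity[OF S(3)[OF that]] by (simp only: G_def X_def mult.commute)
    also have "\<dots> = (\<Sum>b\<in>B. \<Sum>j\<in>X. c (b, j) * cis (2 * pi * real n * t (b, j)))"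
    proof (unfold sum_product, intro sum.cong refl)
      fix b j
      have "cis (2 * pi * real n * t (b, j)) = cis (2 * pi * real n * \<beta> b) * cis (2 * pi * real n * sieve_frac j)"
        by (simp add: t_def cis_mult distrib_left)
      then show "f b * cis (2 * pi * real n * \<beta> b) * (of_real ((- 1) ^ card (fst j) * sieve_weight j) * cis (2 * pi * real n * sieve_frac j))
         = c (b, j) * cis (2 * pi * real n * t (b, j))"
        by (simp only: c_def case_prod_conv mult_ac)
    qed
    finally show ?thesis by (simp add: sum.cartesian_product)
  qed
  have near_le: "(\<Sum>b\<in>B. \<Sum>b'\<in>B. if dist_nearest_int (\<beta> b - \<beta> b') < \<eta> then cmod (f b) * cmod (f b') else 0)
      \<le> (1 + 1 / (N * \<delta>)) * ?F2"
  proof -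
    let ?n = "\<lambda>b b'. dist_nearest_int (\<beta> b - \<beta> b') < \<eta>"
    have sym: "dist_nearest_int (\<beta> b - \<beta> b') = dist_nearest_int (\<beta> b' - \<beta> b)" for b b'
      using dist_nearest_int_minus[of "\<beta> b - \<beta> b'"] by simp
    have cnt: "(\<Sum>b'\<in>B. if ?n b' b then c else 0) \<le> (1 + 1 / (N * \<delta>)) * c" if "c \<ge> 0" for b c
    proof -
      have "real (card {b'\<in>B. ?n b' b}) * \<delta> \<le> \<delta> + 2 * \<eta>"
        by (rule card_near_le[OF B \<delta> _ sep]) (use N in \<open>simp add: \<eta>_def\<close>)
      also have "\<dots> = (1 + 1 / (N * \<delta>)) * \<delta>" using \<delta> N by (simp add: \<eta>_def field_simps)
      finally have "real (card {b'\<in>B. ?n b' b}) \<le> 1 + 1 / (N * \<delta>)" using \<delta> by simp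
      then have "real (card {b'\<in>B. ?n b' b}) * c \<le> (1 + 1 / (N * \<delta>)) * c" using that by (rule mult_right_mono)
      then show ?thesis using B by (simp add: sum.If_cases Int_def)
    qed
    have amgm: "cmod (f b) * cmod (f b') \<le> (cmod (f b))\<^sup>2 / 2 + (cmod (f b'))\<^sup>2 / 2" for b b'
      using sum_squares_bound[of "cmod (f b)" "cmod (f b')"] by simp
    have "(\<Sum>b\<in>B. \<Sum>b'\<in>B. if ?n b b' then cmod (f b) * cmod (f b') else 0)
        \<le> (\<Sum>b\<in>B. \<Sum>b'\<in>B. (if ?n b' b then (cmod (f b))\<^sup>2 / 2 else 0) + (if ?n b b' then (cmod (f b'))\<^sup>2 / 2 else 0))"
      by (intro sum_mono) (use amgm sym in auto)
    also have "\<dots> = (\<Sum>b\<in>B. \<Sum>b'\<in>B. if ?n b' b then (cmod (f b))\<^sup>2 / 2 else 0)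
        + (\<Sum>b'\<in>B. \<Sum>b\<in>B. if ?n b b' then (cmod (f b'))\<^sup>2 / 2 else 0)"
      by (simp only: sum.distrib) (subst sum.swap, rule refl)
    also have "\<dots> \<le> (\<Sum>b\<in>B. (1 + 1 / (N * \<delta>)) * ((cmod (f b))\<^sup>2 / 2)) + (\<Sum>b\<in>B. (1 + 1 / (N * \<delta>)) * ((cmod (f b))\<^sup>2 / 2))"
      by (intro add_mono sum_mono cnt) auto
    also have "\<dots> = (1 + 1 / (N * \<delta>)) * ?F2"
      by (simp add: sum_distrib_left flip: sum.distrib) 
    finally show ?thesis .
  qed
  have corr: "correlation P z \<eta> \<tau> \<le> (if dist_nearest_int \<tau> < \<eta> then G else 0) + 2 * G / y" for \<tau>
  proof (cases "dist_nearest_int \<tau> < \<eta>")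
    case True
    have "0 \<le> 2 * G / y" using G y(1) by simp
    then show ?thesis using True correlation_le[OF z(1) \<eta>, of \<tau>] by (simp add: G_def)
  next
    case False
    then show ?thesis using correlation_far_le[OF z(1) \<eta> _ y, of \<tau>] by (simp add: G_def)
  qed
  have "G\<^sup>2 * (\<Sum>n\<in>S. (cmod (?T n))\<^sup>2) = (\<Sum>n\<in>S. (cmod (\<Sum>i\<in>B \<times> X. c i * cis (2 * pi * real n * t i)))\<^sup>2)"
    unfolding sum_distrib_left
  proof (rule sum.cong[OF refl])
    fix n assume "n \<in> S"
    show "G\<^sup>2 * (cmod (?T n))\<^sup>2 = (cmod (\<Sum>i\<in>B \<times> X. c i * cis (2 * pi * real n * t i)))\<^sup>2"
      unfolding twist[OF \<open>n \<in> S\<close>, symmetric] norm_mult norm_of_real power_mult_distrib power2_abs ..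
  qed
  also have "\<dots> \<le> 2486 / 1000 * N * (\<Sum>i\<in>B \<times> X. \<Sum>k\<in>B \<times> X. if dist_nearest_int (t i - t k) < 1 / (2 * N) then cmod (c i) * cmod (c k) else 0)"
    by (rule large_sieve_overlap[OF _ N S(1,2)]) (use B finX in auto)
  also have "(\<Sum>i\<in>B \<times> X. \<Sum>k\<in>B \<times> X. if dist_nearest_int (t i - t k) < 1 / (2 * N) then cmod (c i) * cmod (c k) else 0)
      = (\<Sum>b\<in>B. \<Sum>b'\<in>B. cmod (f b) * cmod (f b') * correlation P z \<eta> (\<beta> b - \<beta> b'))"
  proof -
    have pairs: "(\<Sum>i\<in>B \<times> X. F i) = (\<Sum>b\<in>B. \<Sum>j\<in>X. F (b, j))" for F :: "_ \<Rightarrow> real"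
      by (simp add: sum.cartesian_product split_def)
    have "(\<Sum>i\<in>B \<times> X. \<Sum>k\<in>B \<times> X. if dist_nearest_int (t i - t k) < 1 / (2 * N) then cmod (c i) * cmod (c k) else 0)
        = (\<Sum>b\<in>B. \<Sum>j\<in>X. \<Sum>b'\<in>B. \<Sum>k\<in>X. if dist_nearest_int (t (b, j) - t (b', k)) < 1 / (2 * N) then cmod (c (b, j)) * cmod (c (b', k)) else 0)"
      by (simp only: pairs)
    also have "\<dots> = (\<Sum>b\<in>B. \<Sum>b'\<in>B. \<Sum>j\<in>X. \<Sum>k\<in>X. if dist_nearest_int (t (b, j) - t (b', k)) < 1 / (2 * N) then cmod (c (b, j)) * cmod (c (b', k)) else 0)"
      by (intro sum.cong refl) (rule sum.swap)
    also have "\<dots> = (\<Sum>b\<in>B. \<Sum>b'\<in>B. cmod (f b) * cmod (f b') * correlation P z \<eta> (\<beta> b - \<beta> b'))"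
      unfolding correlation_def sum_distrib_left X_def
      by (intro sum.cong refl) (simp add: cmodc t_def \<eta>_def algebra_simps)
    finally show ?thesis .
  qed
  also have "\<dots> \<le> (\<Sum>b\<in>B. \<Sum>b'\<in>B. cmod (f b) * cmod (f b') * ((if dist_nearest_int (\<beta> b - \<beta> b') < \<eta> then G else 0) + 2 * G / y))"
    by (intro sum_mono mult_left_mono corr) auto
  also have "\<dots> = G * (\<Sum>b\<in>B. \<Sum>b'\<in>B. if dist_nearest_int (\<beta> b - \<beta> b') < \<eta> then cmod (f b) * cmod (f b') else 0) + 2 * G / y * ?F1\<^sup>2"
  proof -
    have "cmod (f b) * cmod (f b') * ((if dist_nearest_int (\<beta> b - \<beta> b') < \<eta> then G else 0) + 2 * G / y)
        = G * (if dist_nearest_int (\<beta> b - \<beta> b') < \<eta> then cmod (f b) * cmod (f b') else 0) + 2 * G / y * (cmod (f b) * cmod (f b'))" for b b'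
      by (simp add: algebra_simps)
    then show ?thesis by (simp only: sum.distrib sum_distrib_left [symmetric] power2_eq_square sum_product)
  qed
  also have "\<dots> \<le> G * ((1 + 1 / (N * \<delta>)) * ?F2) + 2 * G / y * ?F1\<^sup>2"
    using G y(1) by (intro add_mono mult_left_mono near_le) auto
  finally have "G\<^sup>2 * (\<Sum>n\<in>S. (cmod (?T n))\<^sup>2)
      \<le> 2486 / 1000 * N * (G * ((1 + 1 / (N * \<delta>)) * ?F2) + 2 * G / y * ?F1\<^sup>2)"
    using N by simp
  also have "\<dots> = G * (2486 / 1000 * ((N + 1 / \<delta>) * ?F2 + 2 * N / y * ?F1\<^sup>2))"
    using N \<delta> y(1) by (simp add: field_simps)
  finally have "G * (G * (\<Sum>n\<in>S. (cmod (?T n))\<^sup>2)) \<le> G * (2486 / 1000 * ((N + 1 / \<delta>) * ?F2 + 2 * N / y * ?F1\<^sup>2))"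
    by (simp only: power2_eq_square mult.assoc)
  then show ?thesis using G by (simp add: G_def)
qed

section \<open>The exponential sum over the primes\<close>

text \<open>The sieve with \<open>y = 2 K\<close>, which balances the contributions of near and far pairs, and \<open>z\<close> the integer part
of the fourth root of \<open>N\<close>.\<close>

lemma large_sieve_primes_gt:
  fixes f :: "'b \<Rightarrow> complex" and \<beta> :: "'b \<Rightarrow> real" and K \<delta> M N :: real
  assumes N: "N \<ge> 1" and K: "K \<ge> 1" and B: "finite B" and \<delta>: "\<delta> > 0"
    and sep: "\<And>b b'. b \<in> B \<Longrightarrow> b' \<in> B \<Longrightarrow> b \<noteq> b' \<Longrightarrow> \<delta> \<le> dist_nearest_int (\<beta> b - \<beta> b')"
    and F: "(\<Sum>b\<in>B. cmod (f b))\<^sup>2 = K * (\<Sum>b\<in>B. (cmod (f b))\<^sup>2)"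
    and S: "finite S" "\<And>n. n \<in> S \<Longrightarrow> M + 1 \<le> real n \<and> real n \<le> M + N"
      "\<And>n. n \<in> S \<Longrightarrow> prime n \<and> sqrt (sqrt N) < real n"
  shows "ln N * (\<Sum>n\<in>S. (cmod (\<Sum>b\<in>B. f b * cis (2 * pi * real n * \<beta> b)))\<^sup>2)
     \<le> 276 * (N + 1 / \<delta>) * (\<Sum>b\<in>B. (cmod (f b))\<^sup>2) * ln (2 * K)"
    (is "_ * ?L \<le> _ * ?F2 * _")
proof -
  define s where "s = sqrt (sqrt N)"
  have s: "s \<ge> 1" "s ^ 4 = N" using N by (auto simp: s_def power4_eq_xxxx mult.assoc)
  define z where "z = nat \<lfloor>s\<rfloor>"
  have z: "z \<ge> 1" "real z \<le> s" "s \<le> real z + 1"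
    using s(1) by (auto simp: z_def le_nat_iff)
  define r where "r = nat \<lfloor>(2 * K)\<^sup>2\<rfloor>"
  have "(2 * K)\<^sup>2 \<ge> 2\<^sup>2" using K by (intro power_mono) auto
  then have r: "r \<ge> 4" "real r \<le> (2 * K)\<^sup>2" "(2 * K)\<^sup>2 < real r + 1"
    by (auto simp: r_def le_nat_iff le_floor_iff)
  define P where "P = {p. prime p \<and> r < p \<and> p \<le> z}"
  have P: "finite P" "\<And>p. p \<in> P \<Longrightarrow> prime p" "\<And>p. p \<in> P \<Longrightarrow> (2 * K)\<^sup>2 < real p"
    using r(3) by (auto simp: P_def intro: finite_subset[of _ "{..z}"])
  define G where "G = sieve_sum P z"
  have G: "G \<ge> 1" unfolding G_def by (rule sieve_sum_ge_1[OF P(1) z(1)])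
  have F2: "?F2 \<ge> 0" and L0: "?L \<ge> 0" by (auto intro: sum_nonneg)
  have NF2: "N * ?F2 \<le> (N + 1 / \<delta>) * ?F2" using \<delta> F2 by (intro mult_right_mono) auto
  have "G * ?L \<le> 2486 / 1000 * ((N + 1 / \<delta>) * ?F2 + 2 * N / (2 * K) * (\<Sum>b\<in>B. cmod (f b))\<^sup>2)"
    unfolding G_def
  proof (rule large_sieve_sifted[OF P(1,2) z(1) _ _ P(3) B \<delta> sep S(1,2)])
    have "real z ^ 4 \<le> s ^ 4" using z(2) by (intro power_mono) auto
    then show "real (z ^ 4) \<le> N" using s(2) by simp
    show "0 < 2 * K" using K by simp
    fix n p assume n: "n \<in> S" and p: "p \<in> P"
    have "real z < real n" using S(3)[OF n] z(2) by (simp add: s_def)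
    then have "p \<noteq> n" using p by (auto simp: P_def)
    then show "\<not> p dvd n" using primes_dvd_imp_eq[of p n] S(3)[OF n] P(2)[OF p] by blast
  qed
  also have "2 * N / (2 * K) * (\<Sum>b\<in>B. cmod (f b))\<^sup>2 = N * ?F2" unfolding F using K by simp
  also have "(N + 1 / \<delta>) * ?F2 + N * ?F2 \<le> 2 * ((N + 1 / \<delta>) * ?F2)"
    using NF2 by simp
  finally have main: "G * ?L \<le> 4972 / 1000 * ((N + 1 / \<delta>) * ?F2)" by simp
  have lnN: "ln N = 4 * ln s" using s by (simp add: ln_realpow flip: s(2))
  have "ln s \<le> ln (real z + 1)" using s z by simp
  also have "\<dots> \<le> 1647 / 1000 * (21 / 5 * ln (real r)) * G"
    unfolding G_def P_def by (rule sieve_sum_lower_bound[OF r(1)])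
  also have "\<dots> \<le> 1647 / 1000 * (21 / 5 * (2 * ln (2 * K))) * G"
  proof -
    have "ln (real r) \<le> ln ((2 * K)\<^sup>2)" using r by (subst ln_le_cancel_iff) auto
    also have "\<dots> = 2 * ln (2 * K)" using K by (subst ln_realpow) auto
    finally show ?thesis using G by (intro mult_right_mono mult_left_mono) auto
  qed
  finally have "ln N \<le> 553392 / 10000 * ln (2 * K) * G" using lnN by simp
  then have "ln N * ?L \<le> 553392 / 10000 * ln (2 * K) * G * ?L" using L0 by (rule mult_right_mono)
  also have "\<dots> = 553392 / 10000 * ln (2 * K) * (G * ?L)" by simp
  also have "\<dots> \<le> 553392 / 10000 * ln (2 * K) * (4972 / 1000 * ((N + 1 / \<delta>) * ?F2))"
    using K main by (intro mult_left_mono) auto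
  also have "\<dots> = (553392 / 10000 * 4972 / 1000) * ((N + 1 / \<delta>) * ?F2 * ln (2 * K))" by simp
  also have "\<dots> \<le> 276 * ((N + 1 / \<delta>) * ?F2 * ln (2 * K))"
    using K N \<delta> F2 by (intro mult_right_mono mult_nonneg_nonneg) auto
  finally show ?thesis by (simp only: mult.assoc)
qed

text \<open>If \<open>2 K\<close> is at least \<open>N powr (1/100)\<close>, the factor \<open>ln (2 K) / ln N\<close> is bounded below and the unsifted large
sieve suffices.  Otherwise there are at most \<open>N powr (1/4)\<close> primes up to \<open>N powr (1/4)\<close>, and each of them
contributes at most \<open>K * F2\<close>, which uses up \<open>4\<close> of the \<open>280\<close> units; the remaining primes are sifted.\<close>

lemma large_sieve_primes:
  fixes f :: "'b \<Rightarrow> complex" and \<beta> :: "'b \<Rightarrow> real" and K \<delta> M N :: real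
  assumes N: "N > 1" and K: "K \<ge> 1" and B: "finite B" and \<delta>: "\<delta> > 0"
    and sep: "\<And>b b'. b \<in> B \<Longrightarrow> b' \<in> B \<Longrightarrow> b \<noteq> b' \<Longrightarrow> \<delta> \<le> dist_nearest_int (\<beta> b - \<beta> b')"
    and F: "(\<Sum>b\<in>B. cmod (f b))\<^sup>2 = K * (\<Sum>b\<in>B. (cmod (f b))\<^sup>2)"
    and S: "finite S" "\<And>n. n \<in> S \<Longrightarrow> prime n \<and> M + 1 \<le> real n \<and> real n \<le> M + N"
  shows "(\<Sum>n\<in>S. (cmod (\<Sum>b\<in>B. f b * cis (2 * pi * real n * \<beta> b)))\<^sup>2)
     \<le> 280 * (N + 1 / \<delta>) * (\<Sum>b\<in>B. (cmod (f b))\<^sup>2) * (ln (2 * K) / ln N)"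
    (is "?L \<le> _ * ?F2 * _")
proof -
  let ?T = "\<lambda>n. (cmod (\<Sum>b\<in>B. f b * cis (2 * pi * real n * \<beta> b)))\<^sup>2"
  have F2: "?F2 \<ge> 0" and L0: "?L \<ge> 0" by (auto intro: sum_nonneg)
  have lnN: "ln N > 0" using N by simp
  define V where "V = (N + 1 / \<delta>) * ?F2"
  have V: "N * ?F2 \<le> V" "0 \<le> V" using \<delta> F2 N by (auto simp: V_def algebra_simps)
  have "ln N * ?L \<le> 280 * V * ln (2 * K)"
  proof (cases "ln N \<le> 100 * ln (2 * K)")
    case True
    have "?L \<le> sieve_sum {} 1 * ?L"
      using mult_right_mono[OF sieve_sum_ge_1[of "{}" 1] L0] by simp
    \<comment> \<open>with no sieving primes \<open>y\<close> is arbitrary; \<open>20 K\<close> makes the far pairs cost a tenth of the main term at most\<close>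
    also have "\<dots> \<le> 2486 / 1000 * ((N + 1 / \<delta>) * ?F2 + 2 * N / (20 * K) * (\<Sum>b\<in>B. cmod (f b))\<^sup>2)"
      by (rule large_sieve_sifted[OF _ _ _ _ _ _ B \<delta> sep S(1)]) (use N K S(2) in auto)
    also have "2 * N / (20 * K) * (\<Sum>b\<in>B. cmod (f b))\<^sup>2 = N * ?F2 / 10" unfolding F using K by simp
    also have "2486 / 1000 * ((N + 1 / \<delta>) * ?F2 + N * ?F2 / 10) \<le> 28 / 10 * V"
      using V by (simp flip: V_def)
    finally have "ln N * ?L \<le> ln N * (28 / 10 * V)" using lnN by (intro mult_left_mono) auto
    also have "\<dots> \<le> (100 * ln (2 * K)) * (28 / 10 * V)" using True V by (intro mult_right_mono) auto
    finally show ?thesis by simp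
  next
    case False
    define s where "s = sqrt (sqrt N)"
    have s: "s > 1" "s ^ 4 = N" using N by (auto simp: s_def power4_eq_xxxx mult.assoc)
    have lns: "ln N = 4 * ln s" using s by (simp add: ln_realpow flip: s(2))
    define S1 where "S1 = {n \<in> S. s < real n}"
    define S2 where "S2 = {n \<in> S. real n \<le> s}"
    have split: "S = S1 \<union> S2" "S1 \<inter> S2 = {}" "finite S1" "finite S2"
      using S(1) by (auto simp: S1_def S2_def)
    have 1: "ln N * sum ?T S1 \<le> 276 * V * ln (2 * K)"
      unfolding V_def mult.assoc[symmetric]
      by (rule large_sieve_primes_gt[OF _ K B \<delta> sep F split(3), where M = M]) (use N S(2) in \<open>auto simp: S1_def s_def\<close>)
    have 2: "ln N * sum ?T S2 \<le> 4 * V * ln (2 * K)"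
    proof -
      have T: "?T n \<le> K * ?F2" for n
      proof -
        have "cmod (\<Sum>b\<in>B. f b * cis (2 * pi * real n * \<beta> b)) \<le> (\<Sum>b\<in>B. cmod (f b * cis (2 * pi * real n * \<beta> b)))"
          by (rule norm_sum)
        also have "\<dots> = (\<Sum>b\<in>B. cmod (f b))" by (simp add: norm_mult)
        finally show ?thesis unfolding F [symmetric] by (intro power_mono) auto
      qed
      have "S2 \<subseteq> {1..nat \<lfloor>s\<rfloor>}"
      proof
        fix n assume n: "n \<in> S2"
        then have "n \<ge> 1" using S(2)[of n] prime_ge_1_nat by (auto simp: S2_def)
        moreover have "n \<le> nat \<lfloor>s\<rfloor>" using n by (simp add: S2_def le_nat_floor)
        ultimately show "n \<in> {1..nat \<lfloor>s\<rfloor>}" by simp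
      qed
      then have "card S2 \<le> nat \<lfloor>s\<rfloor>" using card_mono[of "{1..nat \<lfloor>s\<rfloor>}" S2] by simp
      then have card: "real (card S2) \<le> s" using s(1) by linarith
      have "0 \<le> ln (2 * K)" using K by simp
      then have "ln (2 * K) < ln s" using False lns by linarith
      then have K2: "K \<le> s / 2" using K s(1) by simp
      have "ln N \<le> 2 * s\<^sup>2"
        using ln_le_minus_one[of "s\<^sup>2"] s(1) lns by (simp add: ln_realpow)
      moreover have "sum ?T S2 \<le> s * (s / 2 * ?F2)"
      proof -
        have "sum ?T S2 \<le> real (card S2) * (K * ?F2)" by (rule sum_bounded_above) (rule T)
        also have "\<dots> \<le> s * (s / 2 * ?F2)"
          using card K2 F2 K s(1) by (intro mult_mono mult_right_mono mult_nonneg_nonneg) auto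
        finally show ?thesis .
      qed
      ultimately have "ln N * sum ?T S2 \<le> 2 * s\<^sup>2 * (s * (s / 2 * ?F2))"
        using lnN by (intro mult_mono) (auto intro: sum_nonneg)
      also have "\<dots> = N * ?F2" using s(2) by (simp add: power2_eq_square power4_eq_xxxx mult_ac)
      also have "\<dots> \<le> V * 1" using V by simp
      also have "\<dots> \<le> V * (4 * ln (2 * K))"
      proof (rule mult_left_mono[OF _ V(2)])
        have "2 / 3 \<le> ln (2 :: real)" by (rule ln2_ge_two_thirds)
        also have "\<dots> \<le> ln (2 * K)" using K by simp
        finally show "1 \<le> 4 * ln (2 * K)" by simp
      qed
      finally show ?thesis by (simp only: mult_ac)
    qed
    have "?L = sum ?T S1 + sum ?T S2" unfolding split(1) by (rule sum.union_disjoint) (use split in auto)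
    then show ?thesis using 1 2 by (simp add: distrib_left)
  qed
  then have "?L \<le> 280 * V * ln (2 * K) / ln N" using lnN by (simp add: pos_le_divide_eq mult.commute)
  then show ?thesis by (simp only: V_def mult.assoc times_divide_eq_right)
qed

section \<open>Passing to representatives of classes modulo 1\<close>

lemma abs_rep_real_mod_int [simp]: "abs_real_mod_int (rep_real_mod_int b) = b"
  by (rule Quotient3_abs_rep[OF Quotient3_real_mod_int])

lemma norm_mod_int_diff_eq:
  "norm_mod_int (b - b') = dist_nearest_int (rep_real_mod_int b - rep_real_mod_int b')"
  using norm_mod_int.abs_eq[of "rep_real_mod_int b - rep_real_mod_int b'"]
    minus_real_mod_int.abs_eq[of "rep_real_mod_int b" "rep_real_mod_int b'"] by simp

lemma e_smult_nat_eq: "e (smult_nat n b) = cis (2 * pi * real n * rep_real_mod_int b)"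
  using e.abs_eq[of "real n * rep_real_mod_int b"] smult_nat.abs_eq[of n "rep_real_mod_int b"]
  by (simp add: cis_conv_exp mult_ac)

lemma lq_norm_1: "lq_norm B 1 f = (\<Sum>b\<in>B. cmod (f b))"
  by (simp add: lq_norm_def sum_nonneg)

lemma lq_norm_2_squared: "(lq_norm B 2 f)\<^sup>2 = (\<Sum>b\<in>B. (cmod (f b))\<^sup>2)"
  by (simp add: lq_norm_def powr_half_sqrt sum_nonneg)

theorem theorem10p1:
  fixes N M \<delta> :: real
    and B :: "real_mod_int set"
    and f :: "real_mod_int \<Rightarrow> complex"
  assumes "N \<ge> 1000"
    and "M \<ge> 0"
    and "\<delta> > 0"
    and "well_spaced \<delta> B"
    and "\<exists>b\<in>B. f b \<noteq> 0"
  shows "(\<Sum>p | prime (p::nat) \<and> M + 1 \<le> real p \<and> real p \<le> M + N.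
            (cmod (\<Sum>b\<in>B. f b * e (smult_nat p b)))\<^sup>2)
         \<le> 280 * (N + inverse \<delta>) * (lq_norm B 2 f)\<^sup>2
             * (ln (2 * (lq_norm B 1 f)\<^sup>2 / (lq_norm B 2 f)\<^sup>2) / ln N)"
proof (cases "finite B")
  case False
  then show ?thesis by (simp add: lq_norm_2_squared)
next
  case True
  let ?S = "{p. prime (p::nat) \<and> M + 1 \<le> real p \<and> real p \<le> M + N}"
  let ?F1 = "\<Sum>b\<in>B. cmod (f b)" and ?F2 = "\<Sum>b\<in>B. (cmod (f b))\<^sup>2"
  have "?S \<subseteq> {..nat \<lfloor>M + N\<rfloor>}" by (auto simp: le_nat_floor)
  then have finS: "finite ?S" by (rule finite_subset) simp
  obtain b0 where b0: "b0 \<in> B" "f b0 \<noteq> 0" using assms(5) by blast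
  have F2: "?F2 > 0" using True b0 by (intro sum_pos2[of _ b0]) auto
  have F12: "?F2 \<le> ?F1\<^sup>2"
  proof -
    have "?F2 \<le> (\<Sum>b\<in>B. cmod (f b) * ?F1)"
      unfolding power2_eq_square using True by (intro sum_mono mult_left_mono member_le_sum) auto
    then show ?thesis by (simp add: power2_eq_square sum_distrib_right)
  qed
  define K where "K = ?F1\<^sup>2 / ?F2"
  have K: "K \<ge> 1" "?F1\<^sup>2 = K * ?F2" using F2 F12 by (simp_all add: K_def)
  have "(\<Sum>p\<in>?S. (cmod (\<Sum>b\<in>B. f b * cis (2 * pi * real p * rep_real_mod_int b)))\<^sup>2)
      \<le> 280 * (N + 1 / \<delta>) * ?F2 * (ln (2 * K) / ln N)"
  proof (rule large_sieve_primes[OF _ K(1) True assms(3) _ K(2) finS])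
    fix b b' assume "b \<in> B" "b' \<in> B" "b \<noteq> b'"
    then show "\<delta> \<le> dist_nearest_int (rep_real_mod_int b - rep_real_mod_int b')"
      using assms(4) by (auto simp: well_spaced_def norm_mod_int_diff_eq)
  qed (use assms(1) in auto)
  then show ?thesis
    by (simp add: e_smult_nat_eq lq_norm_1 lq_norm_2_squared K_def inverse_eq_divide)
qed

end
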